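(* Let $(X,\mathfrak S)$ be a hierarchically hyperbolic space, and let $\sigma$ be the metric on $X$ defined in the context. Then $(X,\sigma)$ admits a roughly conical, roughly reversible, quasigeodesic bicombing that is coarsely equivariant under the automorphism group of $(X,\mathfrak S)$. More strongly, the combing lines are rough geodesics for the metric $\sigma$ (with uniform constants).
   Context: Bicombings. A quasigeodesic bicombing on a metric space $(X,\sigma)$ is a map $\gamma:X\times X\times[0,1]\to X$ such that for each distinct pair $a,b\in X$ the map $[0,\sigma(a,b)]\to X$, $t\mapsto\gamma_{a,b}(t/\sigma(a,b))$, is a quasigeodesic from $a$ to $b$ with uniform constants. Its combing lines are rough geodesics if these maps are $(1,C)$-quasi-isometric embeddings for a uniform $C$. It is roughly conical if there is $C\ge0$ with $\sigma(\gamma_{a,b}(t),\gamma_{a',b'}(t))\le(1-t)\sigma(a,a')+t\sigma(b,b')+C$ for all $a,b,a',b'\in X$, $t\in[0,1]$; roughly reversible if there is $C\ge0$ with $\sigma(\gamma_{a,b}(t),\gamma_{b,a}(1-t))\le C$ for all $a,b,t$; coarsely equivariant under a group $G$ acting on $X$ if there is $C\ge0$ with $\sigma(g\gamma_{a,b}(t),\gamma_{ga,gb}(t))\le C$ for all $g\in G$ and all $a,b,t$. Hierarchically hyperbolic space (HHS). A quasigeodesic metric space $(X,d)$ is an HHS, written $(X,\mathfrak S)$, if there are a constant $E\ge 1$, a set $\mathfrak S$ (of "domains"), and for each $U\in\mathfrak S$ a geodesic $E$-hyperbolic space $\mathcal CU$, with the following. Write $d_U(x,y)=d_{\mathcal CU}(\pi_U(x),\pi_U(y))$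 for $x,y\in X$, and similarly for subsets of $X$ or $\mathcal CU$; distances between sets are infima. (It is a standing convention that $X$ is moreover a geodesic space, e.g. a graph.) (1) Projections: for each $U$ there is an $E$-coarsely onto, $(E,E)$-coarsely Lipschitz map $\pi_U:X\to\mathcal CU$. (2) Nesting: $\mathfrak S$ has a partial order $\sqsubseteq$ with a unique maximal element (if $\mathfrak S\ne\emptyset$). If $U\sqsubsetneq V$ there are a nonempty set $\rho^U_V\subset\mathcal CV$ of diameter at most $E$ and a map $\rho^V_U:\mathcal CV\to\mathcal CU$. (3) Orthogonality: there is a symmetric, anti-reflexive relation $\bot$ on $\mathfrak S$; if $U\sqsubseteq V$ and $V\bot W$ then $U\bot W$; orthogonal domains are not $\sqsubseteq$-comparable; for each $T\in\mathfrak S$ and $U\sqsubseteq T$ such that some $V\sqsubseteq T$ has $V\bot U$, there is $W\sqsubsetneq T$ such that every $V\sqsubseteq T$ with $V\bot U$ satisfies $V\sqsubseteq W$. (4) Transversality and consistency: $U,V$ are transverse, $U\pitchfork V$, if they are neither orthogonal nor $\sqsubseteq$-comparable; then there are nonempty sets $\rho^U_V\subset\mathcal CV$, $\rho^V_U\subset\mathcal CU$ of diameter at most $E$ with $\min\{d_U(x,\rho^V_U),d_V(x,\rho^U_V)\}\le E$ for all $x\in X$. If $U\sqsubsetneq V$ then $\min\{d_V(x,\rho^U_V),\operatorname{diam}(\{\pi_U(x)\}\cup\rho^V_U(\pi_V(x)))\}\le E$ for all $x\in X$. If $U\sqsubseteq V$, then $d_W(\rho^U_W,\rho^V_W)\le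 E$ whenever $V\sqsubsetneq W$, or $V\pitchfork W$ and $W\not\perp U$. (5) Finite complexity: the cardinalities of sets of pairwise $\sqsubseteq$-comparable domains are at most $E$. (6) Large links: for $W\in\mathfrak S$ and $x,x'\in X$, put $N=E\,d_W(x,x')+E$. There are $T_1,\dots,T_{\lfloor N\rfloor}\sqsubsetneq W$ such that every $T\sqsubsetneq W$ satisfies $T\sqsubseteq T_i$ for some $i$ or $d_T(x,x')<E$; and $d_W(x,\rho^{T_i}_W)\le N$ for all $i$. (7) Bounded geodesic image: if $U\sqsubsetneq V$ and $\gamma\subset\mathcal CV$ is a geodesic with $d_V(\gamma,\rho^U_V)>E$, then $\operatorname{diam}\rho^V_U(\gamma)\le E$. (8) Partial realisation: if $\{U_i\}$ is a set of pairwise orthogonal domains and $p_i\in\mathcal CU_i$, there is $x\in X$ with $d_{U_i}(x,p_i)\le E$ for all $i$ and $d_V(x,\rho^{U_i}_V)\le E$ whenever $U_i\sqsubsetneq V$ or $U_i\pitchfork V$. (9) Uniqueness: for each $\kappa\ge0$ there is $\theta(\kappa)$ such that if $d(x,y)\ge\theta(\kappa)$ then $d_V(x,y)\ge\kappa$ for some $V\in\mathfrak S$. Automorphisms. An automorphism of $(X,\mathfrak S)$ is an isometry $g$ of $(X,d)$ together with a bijection $U\mapsto gU$ of $\mathfrak S$ preserving $\sqsubseteq$ and $\bot$ and isometries $g:\mathcal CU\to\mathcal C(gU)$ such that $g\pi_U(x)=\pi_{gU}(gx)$ for all $x,U$, and $g\rho^U_V=\rho^{gU}_{gV}$ whenever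 $U\sqsubsetneq V$ or $U\pitchfork V$. Coarse median on an HHS. For $x,y,z\in X$ let $m_U$ be a (coarse) median of $\pi_U(x),\pi_U(y),\pi_U(z)$ in the hyperbolic space $\mathcal CU$. By the realisation theorem for HHSs there is a point $\mu(x,y,z)\in X$ with $d_U(\mu(x,y,z),m_U)$ uniformly bounded over all $U\in\mathfrak S$ and all $x,y,z$; this defines $\mu:X^3\to X$, making $(X,\mu,d)$ a coarse median space. It is taken to be equivariant under automorphisms of $(X,\mathfrak S)$. The metric $\sigma$. Fix $K>0$. A $K$-contraction is a map $\Phi:X\to\mathbb R$ with $|\Phi(x)-\Phi(y)|\le d(x,y)+K$ for all $x,y$ and $|\Phi(\mu(x,y,z))-\mu_{\mathbb R}(\Phi(x),\Phi(y),\Phi(z))|\le K$ for all $x,y,z$, where $\mu_{\mathbb R}$ is the standard median on $\mathbb R$. Then $\sigma(a,b)$ is the supremum of all $r\ge0$ for which there is a $K$-contraction $\Phi$ with $\Phi(a)=0$ and $\Phi(b)=r$. *)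

theory Defs
  imports "HOL-Analysis.Analysis"
begin

text \<open>Metric spaces are given by a carrier set \<open>M\<close> and a distance function \<open>d\<close>, as in the library
  locale \<^locale>\<open>Metric_space\<close>.\<close>

section \<open>Geodesics, quasigeodesics and hyperbolicity\<close>

definition qi_embedding ::
  "real \<Rightarrow> real \<Rightarrow> 'a set \<Rightarrow> ('a \<Rightarrow> 'a \<Rightarrow> real) \<Rightarrow> real \<Rightarrow> (real \<Rightarrow> 'a) \<Rightarrow> bool" where
  "qi_embedding k c M d L f \<longleftrightarrow>
     f ` {0..L} \<subseteq> M \<and>
     (\<forall>s\<in>{0..L}. \<forall>t\<in>{0..L}.
        \<bar>s - t\<bar> / k - c \<le> d (f s) (f t) \<and> d (f s) (f t) \<le> k * \<bar>s - t\<bar> + c)"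

definition quasigeodesic ::
  "real \<Rightarrow> real \<Rightarrow> 'a set \<Rightarrow> ('a \<Rightarrow> 'a \<Rightarrow> real) \<Rightarrow> 'a \<Rightarrow> 'a \<Rightarrow> real \<Rightarrow> (real \<Rightarrow> 'a) \<Rightarrow> bool" where
  "quasigeodesic k c M d a b L f \<longleftrightarrow> qi_embedding k c M d L f \<and> f 0 = a \<and> f L = b"

definition quasigeodesic_space :: "'a set \<Rightarrow> ('a \<Rightarrow> 'a \<Rightarrow> real) \<Rightarrow> bool" where
  "quasigeodesic_space M d \<longleftrightarrow>
     (\<exists>k\<ge>1. \<exists>c\<ge>0. \<forall>a\<in>M. \<forall>b\<in>M. \<exists>L\<ge>0. \<exists>f. quasigeodesic k c M d a b L f)"

definition geodesic_segment ::
  "'a set \<Rightarrow> ('a \<Rightarrow> 'a \<Rightarrow> real) \<Rightarrow> 'a \<Rightarrow> 'a \<Rightarrow> 'a set \<Rightarrow> bool" where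
  "geodesic_segment M d a b A \<longleftrightarrow>
     (\<exists>f. f 0 = a \<and> f (d a b) = b \<and> f ` {0..d a b} \<subseteq> M \<and>
          (\<forall>s\<in>{0..d a b}. \<forall>t\<in>{0..d a b}. d (f s) (f t) = \<bar>s - t\<bar>) \<and>
          A = f ` {0..d a b})"

definition geodesic_space :: "'a set \<Rightarrow> ('a \<Rightarrow> 'a \<Rightarrow> real) \<Rightarrow> bool" where
  "geodesic_space M d \<longleftrightarrow> (\<forall>a\<in>M. \<forall>b\<in>M. \<exists>A. geodesic_segment M d a b A)"

text \<open>Hyperbolicity is the slim triangle condition, for geodesic spaces.\<close>

definition hyperbolic_space :: "real \<Rightarrow> 'a set \<Rightarrow> ('a \<Rightarrow> 'a \<Rightarrow> real) \<Rightarrow> bool" where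
  "hyperbolic_space \<delta> M d \<longleftrightarrow>
     (\<forall>a\<in>M. \<forall>b\<in>M. \<forall>c\<in>M. \<forall>A B C.
        geodesic_segment M d a b A \<and> geodesic_segment M d b c B \<and> geodesic_segment M d a c C \<longrightarrow>
        (\<forall>p\<in>A. \<exists>q\<in>B \<union> C. d p q \<le> \<delta>))"

text \<open>A coarse median of three points of a hyperbolic space is a coarse centre of the geodesic
  triangles they span: a point within \<open>r\<close> of all sides.\<close>

definition coarse_centre ::
  "real \<Rightarrow> 'a set \<Rightarrow> ('a \<Rightarrow> 'a \<Rightarrow> real) \<Rightarrow> 'a \<Rightarrow> 'a \<Rightarrow> 'a \<Rightarrow> 'a \<Rightarrow> bool" where
  "coarse_centre r M d a b c m \<longleftrightarrow>
     m \<in> M \<and>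
     (\<forall>A. geodesic_segment M d a b A \<or> geodesic_segment M d b c A \<or> geodesic_segment M d a c A \<longrightarrow>
        (\<exists>q\<in>A. d m q \<le> r))"

definition isometry_between ::
  "'a set \<Rightarrow> ('a \<Rightarrow> 'a \<Rightarrow> real) \<Rightarrow> 'b set \<Rightarrow> ('b \<Rightarrow> 'b \<Rightarrow> real) \<Rightarrow> ('a \<Rightarrow> 'b) \<Rightarrow> bool" where
  "isometry_between M d N e f \<longleftrightarrow>
     bij_betw f M N \<and> (\<forall>x\<in>M. \<forall>y\<in>M. e (f x) (f y) = d x y)"

text \<open>Only used for nonempty \<open>A\<close> and \<open>B\<close>.\<close>

definition set_distance :: "('a \<Rightarrow> 'a \<Rightarrow> real) \<Rightarrow> 'a set \<Rightarrow> 'a set \<Rightarrow> real" where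
  "set_distance d A B = (INF (a, b)\<in>A \<times> B. d a b)"

text \<open>The diameter as a bound, since the supremum of an unbounded set of reals is unspecified.\<close>

definition diam_le :: "('a \<Rightarrow> 'a \<Rightarrow> real) \<Rightarrow> 'a set \<Rightarrow> real \<Rightarrow> bool" where
  "diam_le d A r \<longleftrightarrow> (\<forall>a\<in>A. \<forall>b\<in>A. d a b \<le> r)"


section \<open>Hierarchically hyperbolic spaces\<close>

text \<open>The spaces \<open>\<C>U\<close> are arbitrary carriers in one type \<open>'c\<close>, which can be a disjoint union, so this
  is no restriction. The set \<open>\<rho>\<^sup>U\<^sub>V \<subseteq> \<C>V\<close> (for \<open>U\<close> properly nested in, or transverse to, \<open>V\<close>) is
  \<open>rho H U V\<close>, and the map \<open>\<rho>\<^sup>V\<^sub>U : \<C>V \<rightarrow> \<C>U\<close> (for \<open>U\<close> properly nested in \<open>V\<close>) is \<open>rho_map H V U\<close>;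
  superscript first in both.\<close>

record ('x, 'u, 'c) hhs_data =
  points :: "'x set"
  pdist :: "'x \<Rightarrow> 'x \<Rightarrow> real"
  domains :: "'u set"
  nested :: "'u \<Rightarrow> 'u \<Rightarrow> bool"
  orth :: "'u \<Rightarrow> 'u \<Rightarrow> bool"
  cspace :: "'u \<Rightarrow> 'c set"
  cdist :: "'u \<Rightarrow> 'c \<Rightarrow> 'c \<Rightarrow> real"
  proj :: "'u \<Rightarrow> 'x \<Rightarrow> 'c"
  rho :: "'u \<Rightarrow> 'u \<Rightarrow> 'c set"
  rho_map :: "'u \<Rightarrow> 'u \<Rightarrow> 'c \<Rightarrow> 'c"

definition pnested :: "('x, 'u, 'c) hhs_data \<Rightarrow> 'u \<Rightarrow> 'u \<Rightarrow> bool" where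
  "pnested H U V \<longleftrightarrow> nested H U V \<and> U \<noteq> V"

definition transverse :: "('x, 'u, 'c) hhs_data \<Rightarrow> 'u \<Rightarrow> 'u \<Rightarrow> bool" where
  "transverse H U V \<longleftrightarrow> \<not> orth H U V \<and> \<not> nested H U V \<and> \<not> nested H V U"

definition dproj :: "('x, 'u, 'c) hhs_data \<Rightarrow> 'u \<Rightarrow> 'x \<Rightarrow> 'x \<Rightarrow> real" where
  "dproj H U x y = cdist H U (proj H U x) (proj H U y)"

definition dproj_set :: "('x, 'u, 'c) hhs_data \<Rightarrow> 'u \<Rightarrow> 'x \<Rightarrow> 'c set \<Rightarrow> real" where
  "dproj_set H U x A = set_distance (cdist H U) {proj H U x} A"

definition hhs_projections :: "real \<Rightarrow> ('x, 'u, 'c) hhs_data \<Rightarrow> bool" where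
  "hhs_projections E H \<longleftrightarrow>
     (\<forall>U\<in>domains H.
        proj H U ` points H \<subseteq> cspace H U \<and>
        (\<forall>p\<in>cspace H U. \<exists>x\<in>points H. cdist H U (proj H U x) p \<le> E) \<and>
        (\<forall>x\<in>points H. \<forall>y\<in>points H. dproj H U x y \<le> E * pdist H x y + E))"

definition hhs_nesting :: "real \<Rightarrow> ('x, 'u, 'c) hhs_data \<Rightarrow> bool" where
  "hhs_nesting E H \<longleftrightarrow>
     (\<forall>U\<in>domains H. nested H U U) \<and>
     (\<forall>U\<in>domains H. \<forall>V\<in>domains H. nested H U V \<and> nested H V U \<longrightarrow> U = V) \<and>
     (\<forall>U\<in>domains H. \<forall>V\<in>domains H. \<forall>W\<in>domains H.
        nested H U V \<and> nested H V W \<longrightarrow> nested H U W) \<and>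
     (domains H \<noteq> {} \<longrightarrow>
        (\<exists>!S. S \<in> domains H \<and> (\<forall>V\<in>domains H. nested H S V \<longrightarrow> V = S))) \<and>
     (\<forall>U\<in>domains H. \<forall>V\<in>domains H. pnested H U V \<longrightarrow>
        rho H U V \<noteq> {} \<and> rho H U V \<subseteq> cspace H V \<and> diam_le (cdist H V) (rho H U V) E \<and>
        rho_map H V U ` cspace H V \<subseteq> cspace H U)"

definition hhs_orthogonality :: "('x, 'u, 'c) hhs_data \<Rightarrow> bool" where
  "hhs_orthogonality H \<longleftrightarrow>
     (\<forall>U\<in>domains H. \<forall>V\<in>domains H. orth H U V \<longrightarrow> orth H V U) \<and>
     (\<forall>U\<in>domains H. \<not> orth H U U) \<and>
     (\<forall>U\<in>domains H. \<forall>V\<in>domains H. \<forall>W\<in>domains H.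
        nested H U V \<and> orth H V W \<longrightarrow> orth H U W) \<and>
     (\<forall>U\<in>domains H. \<forall>V\<in>domains H. orth H U V \<longrightarrow> \<not> nested H U V \<and> \<not> nested H V U) \<and>
     (\<forall>T\<in>domains H. \<forall>U\<in>domains H.
        nested H U T \<and> (\<exists>V\<in>domains H. nested H V T \<and> orth H V U) \<longrightarrow>
        (\<exists>W\<in>domains H. pnested H W T \<and>
           (\<forall>V\<in>domains H. nested H V T \<and> orth H V U \<longrightarrow> nested H V W)))"

definition hhs_consistency :: "real \<Rightarrow> ('x, 'u, 'c) hhs_data \<Rightarrow> bool" where
  "hhs_consistency E H \<longleftrightarrow>
     (\<forall>U\<in>domains H. \<forall>V\<in>domains H. transverse H U V \<longrightarrow>
        rho H U V \<noteq> {} \<and> rho H U V \<subseteq> cspace H V \<and> diam_le (cdist H V) (rho H U V) E \<and>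
        rho H V U \<noteq> {} \<and> rho H V U \<subseteq> cspace H U \<and> diam_le (cdist H U) (rho H V U) E \<and>
        (\<forall>x\<in>points H. min (dproj_set H U x (rho H V U)) (dproj_set H V x (rho H U V)) \<le> E)) \<and>
     (\<forall>U\<in>domains H. \<forall>V\<in>domains H. pnested H U V \<longrightarrow>
        (\<forall>x\<in>points H. dproj_set H V x (rho H U V) \<le> E \<or>
           diam_le (cdist H U) {proj H U x, rho_map H V U (proj H V x)} E)) \<and>
     (\<forall>U\<in>domains H. \<forall>V\<in>domains H. \<forall>W\<in>domains H.
        nested H U V \<and> (pnested H V W \<or> transverse H V W \<and> \<not> orth H W U) \<longrightarrow>
        set_distance (cdist H W) (rho H U W) (rho H V W) \<le> E)"

definition hhs_finite_complexity :: "real \<Rightarrow> ('x, 'u, 'c) hhs_data \<Rightarrow> bool" where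
  "hhs_finite_complexity E H \<longleftrightarrow>
     (\<forall>A\<subseteq>domains H. (\<forall>U\<in>A. \<forall>V\<in>A. nested H U V \<or> nested H V U) \<longrightarrow>
        finite A \<and> real (card A) \<le> E)"

text \<open>A list \<open>T\<^sub>1, \<dots>, T\<^sub>n\<close> with \<open>n = \<lfloor>N\<rfloor>\<close> is read as a family of at most \<open>\<lfloor>N\<rfloor>\<close> domains: for a minimal
  domain \<open>W\<close> it has to be empty, although \<open>\<lfloor>N\<rfloor> \<ge> 1\<close>.\<close>

definition hhs_large_links :: "real \<Rightarrow> ('x, 'u, 'c) hhs_data \<Rightarrow> bool" where
  "hhs_large_links E H \<longleftrightarrow>
     (\<forall>W\<in>domains H. \<forall>x\<in>points H. \<forall>x'\<in>points H.
        let N = E * dproj H W x x' + E in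
        \<exists>\<T>. \<T> \<subseteq> {T\<in>domains H. pnested H T W} \<and> finite \<T> \<and> int (card \<T>) \<le> \<lfloor>N\<rfloor> \<and>
          (\<forall>T\<in>domains H. pnested H T W \<longrightarrow> (\<exists>T'\<in>\<T>. nested H T T') \<or> dproj H T x x' < E) \<and>
          (\<forall>T'\<in>\<T>. dproj_set H W x (rho H T' W) \<le> N))"

definition hhs_bounded_geodesic_image :: "real \<Rightarrow> ('x, 'u, 'c) hhs_data \<Rightarrow> bool" where
  "hhs_bounded_geodesic_image E H \<longleftrightarrow>
     (\<forall>U\<in>domains H. \<forall>V\<in>domains H. pnested H U V \<longrightarrow>
        (\<forall>p\<in>cspace H V. \<forall>q\<in>cspace H V. \<forall>A. geodesic_segment (cspace H V) (cdist H V) p q A \<longrightarrow>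
           set_distance (cdist H V) A (rho H U V) > E \<longrightarrow>
           diam_le (cdist H U) (rho_map H V U ` A) E))"

definition hhs_partial_realisation :: "real \<Rightarrow> ('x, 'u, 'c) hhs_data \<Rightarrow> bool" where
  "hhs_partial_realisation E H \<longleftrightarrow>
     (\<forall>\<U>\<subseteq>domains H. \<forall>p.
        (\<forall>U\<in>\<U>. \<forall>V\<in>\<U>. U \<noteq> V \<longrightarrow> orth H U V) \<and> (\<forall>U\<in>\<U>. p U \<in> cspace H U) \<longrightarrow>
        (\<exists>x\<in>points H. \<forall>U\<in>\<U>.
           cdist H U (proj H U x) (p U) \<le> E \<and>
           (\<forall>V\<in>domains H. pnested H U V \<or> transverse H U V \<longrightarrow>
              dproj_set H V x (rho H U V) \<le> E)))"

definition hhs_uniqueness :: "('x, 'u, 'c) hhs_data \<Rightarrow> bool" where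
  "hhs_uniqueness H \<longleftrightarrow>
     (\<forall>\<kappa>\<ge>0. \<exists>\<theta>. \<forall>x\<in>points H. \<forall>y\<in>points H.
        pdist H x y \<ge> \<theta> \<longrightarrow> (\<exists>V\<in>domains H. dproj H V x y \<ge> \<kappa>))"

definition hhs :: "('x, 'u, 'c) hhs_data \<Rightarrow> bool" where
  "hhs H \<longleftrightarrow>
     Metric_space (points H) (pdist H) \<and> quasigeodesic_space (points H) (pdist H) \<and>
     (\<exists>E\<ge>1.
        (\<forall>U\<in>domains H. Metric_space (cspace H U) (cdist H U) \<and>
           geodesic_space (cspace H U) (cdist H U) \<and>
           hyperbolic_space E (cspace H U) (cdist H U)) \<and>
        hhs_projections E H \<and> hhs_nesting E H \<and> hhs_orthogonality H \<and> hhs_consistency E H \<and>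
        hhs_finite_complexity E H \<and> hhs_large_links E H \<and> hhs_bounded_geodesic_image E H \<and>
        hhs_partial_realisation E H \<and> hhs_uniqueness H)"


section \<open>Automorphisms\<close>

record ('x, 'u, 'c) hhs_map =
  on_points :: "'x \<Rightarrow> 'x"
  on_domains :: "'u \<Rightarrow> 'u"
  on_cspace :: "'u \<Rightarrow> 'c \<Rightarrow> 'c"

definition hhs_automorphisms :: "('x, 'u, 'c) hhs_data \<Rightarrow> ('x, 'u, 'c) hhs_map set" where
  "hhs_automorphisms H =
     {g. isometry_between (points H) (pdist H) (points H) (pdist H) (on_points g) \<and>
         bij_betw (on_domains g) (domains H) (domains H) \<and>
         (\<forall>U\<in>domains H. \<forall>V\<in>domains H.
            (nested H (on_domains g U) (on_domains g V) \<longleftrightarrow> nested H U V) \<and>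
            (orth H (on_domains g U) (on_domains g V) \<longleftrightarrow> orth H U V)) \<and>
         (\<forall>U\<in>domains H.
            isometry_between (cspace H U) (cdist H U)
              (cspace H (on_domains g U)) (cdist H (on_domains g U)) (on_cspace g U)) \<and>
         (\<forall>U\<in>domains H. \<forall>x\<in>points H.
            on_cspace g U (proj H U x) = proj H (on_domains g U) (on_points g x)) \<and>
         (\<forall>U\<in>domains H. \<forall>V\<in>domains H. pnested H U V \<or> transverse H U V \<longrightarrow>
            on_cspace g V ` rho H U V = rho H (on_domains g U) (on_domains g V))}"


section \<open>Coarse median and the metric \<open>\<sigma>\<close>\<close>

definition hhs_coarse_median :: "('x, 'u, 'c) hhs_data \<Rightarrow> ('x \<Rightarrow> 'x \<Rightarrow> 'x \<Rightarrow> 'x) \<Rightarrow> bool" where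
  "hhs_coarse_median H \<mu> \<longleftrightarrow>
     (\<forall>x\<in>points H. \<forall>y\<in>points H. \<forall>z\<in>points H. \<mu> x y z \<in> points H) \<and>
     (\<exists>r. \<forall>x\<in>points H. \<forall>y\<in>points H. \<forall>z\<in>points H. \<forall>U\<in>domains H. \<exists>m.
        coarse_centre r (cspace H U) (cdist H U) (proj H U x) (proj H U y) (proj H U z) m \<and>
        cdist H U (proj H U (\<mu> x y z)) m \<le> r) \<and>
     (\<forall>g\<in>hhs_automorphisms H. \<forall>x\<in>points H. \<forall>y\<in>points H. \<forall>z\<in>points H.
        \<mu> (on_points g x) (on_points g y) (on_points g z) = on_points g (\<mu> x y z))"

definition real_median :: "real \<Rightarrow> real \<Rightarrow> real \<Rightarrow> real" where
  "real_median a b c = max (min a b) (min (max a b) c)"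

definition contraction ::
  "real \<Rightarrow> 'a set \<Rightarrow> ('a \<Rightarrow> 'a \<Rightarrow> real) \<Rightarrow> ('a \<Rightarrow> 'a \<Rightarrow> 'a \<Rightarrow> 'a) \<Rightarrow> ('a \<Rightarrow> real) \<Rightarrow> bool" where
  "contraction K M d \<mu> \<Phi> \<longleftrightarrow>
     (\<forall>x\<in>M. \<forall>y\<in>M. \<bar>\<Phi> x - \<Phi> y\<bar> \<le> d x y + K) \<and>
     (\<forall>x\<in>M. \<forall>y\<in>M. \<forall>z\<in>M. \<bar>\<Phi> (\<mu> x y z) - real_median (\<Phi> x) (\<Phi> y) (\<Phi> z)\<bar> \<le> K)"

text \<open>On \<open>M\<close> the supremum is over a nonempty set bounded above by \<open>d a b + K\<close>; off \<open>M\<close> the value is a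
  dummy, since \<open>\<Phi>\<close> is unconstrained there.\<close>

definition contraction_dist ::
  "real \<Rightarrow> 'a set \<Rightarrow> ('a \<Rightarrow> 'a \<Rightarrow> real) \<Rightarrow> ('a \<Rightarrow> 'a \<Rightarrow> 'a \<Rightarrow> 'a) \<Rightarrow> 'a \<Rightarrow> 'a \<Rightarrow> real" where
  "contraction_dist K M d \<mu> a b =
     (if a \<in> M \<and> b \<in> M
      then Sup {r. r \<ge> 0 \<and> (\<exists>\<Phi>. contraction K M d \<mu> \<Phi> \<and> \<Phi> a = 0 \<and> \<Phi> b = r)}
      else 0)"


section \<open>Bicombings\<close>

definition quasigeodesic_bicombing ::
  "'a set \<Rightarrow> ('a \<Rightarrow> 'a \<Rightarrow> real) \<Rightarrow> ('a \<Rightarrow> 'a \<Rightarrow> real \<Rightarrow> 'a) \<Rightarrow> bool" where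
  "quasigeodesic_bicombing M \<sigma> \<gamma> \<longleftrightarrow>
     Metric_space M \<sigma> \<and>
     (\<forall>a\<in>M. \<forall>b\<in>M. \<forall>t\<in>{0..1}. \<gamma> a b t \<in> M) \<and>
     (\<exists>k\<ge>1. \<exists>c\<ge>0. \<forall>a\<in>M. \<forall>b\<in>M. a \<noteq> b \<longrightarrow>
        quasigeodesic k c M \<sigma> a b (\<sigma> a b) (\<lambda>t. \<gamma> a b (t / \<sigma> a b)))"

definition rough_geodesic_lines ::
  "'a set \<Rightarrow> ('a \<Rightarrow> 'a \<Rightarrow> real) \<Rightarrow> ('a \<Rightarrow> 'a \<Rightarrow> real \<Rightarrow> 'a) \<Rightarrow> bool" where
  "rough_geodesic_lines M \<sigma> \<gamma> \<longleftrightarrow>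
     (\<exists>C\<ge>0. \<forall>a\<in>M. \<forall>b\<in>M. a \<noteq> b \<longrightarrow>
        qi_embedding 1 C M \<sigma> (\<sigma> a b) (\<lambda>t. \<gamma> a b (t / \<sigma> a b)))"

definition roughly_conical ::
  "'a set \<Rightarrow> ('a \<Rightarrow> 'a \<Rightarrow> real) \<Rightarrow> ('a \<Rightarrow> 'a \<Rightarrow> real \<Rightarrow> 'a) \<Rightarrow> bool" where
  "roughly_conical M \<sigma> \<gamma> \<longleftrightarrow>
     (\<exists>C\<ge>0. \<forall>a\<in>M. \<forall>b\<in>M. \<forall>a'\<in>M. \<forall>b'\<in>M. \<forall>t\<in>{0..1}.
        \<sigma> (\<gamma> a b t) (\<gamma> a' b' t) \<le> (1 - t) * \<sigma> a a' + t * \<sigma> b b' + C)"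

definition roughly_reversible ::
  "'a set \<Rightarrow> ('a \<Rightarrow> 'a \<Rightarrow> real) \<Rightarrow> ('a \<Rightarrow> 'a \<Rightarrow> real \<Rightarrow> 'a) \<Rightarrow> bool" where
  "roughly_reversible M \<sigma> \<gamma> \<longleftrightarrow>
     (\<exists>C\<ge>0. \<forall>a\<in>M. \<forall>b\<in>M. \<forall>t\<in>{0..1}. \<sigma> (\<gamma> a b t) (\<gamma> b a (1 - t)) \<le> C)"

definition coarsely_equivariant ::
  "'g set \<Rightarrow> ('g \<Rightarrow> 'a \<Rightarrow> 'a) \<Rightarrow> 'a set \<Rightarrow> ('a \<Rightarrow> 'a \<Rightarrow> real) \<Rightarrow> ('a \<Rightarrow> 'a \<Rightarrow> real \<Rightarrow> 'a) \<Rightarrow> bool" where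
  "coarsely_equivariant G act M \<sigma> \<gamma> \<longleftrightarrow>
     (\<exists>C\<ge>0. \<forall>g\<in>G. \<forall>a\<in>M. \<forall>b\<in>M. \<forall>t\<in>{0..1}.
        \<sigma> (act g (\<gamma> a b t)) (\<gamma> (act g a) (act g b) t) \<le> C)"

end

theory Submission
  imports Defs
begin

text \<open>
  In the coordinates given by all \<open>K\<close>-contractions, \<open>\<sigma>\<close> is a supremum metric and the coarse median is the
  coordinatewise median up to \<open>K\<close>. If a function \<open>f\<close> satisfies \<open>\<sigma>(x, y) \<le> f(x) + f(y)\<close>, then the
  halfspaces \<open>{\<Phi> \<le> \<Phi>(x) + f(x)}\<close> coarsely meet in pairs, since otherwise two contractions could be
  glued to one that violates the inequality. Finitely many of them meet by the usual Helly argument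
  with medians. A hierarchically hyperbolic space has finite rank: large cubes of contractions are
  visible in pairwise orthogonal domains. Hence boundedly many halfspaces determine all of them, and
  they have a common point. So every extremal function is close to the distance from a point of \<open>X\<close>, that
  is, \<open>(X, \<sigma>)\<close> is coarsely dense in its injective hull. The canonical retraction onto the hull,
  applied to \<open>(1 - t) \<sigma>(a, \<cdot>) + t \<sigma>(b, \<cdot>)\<close>, gives a conical, reversible and equivariant bicombing of the
  hull by geodesics, and the nearby points of \<open>X\<close> form the required bicombing.
\<close>

section \<open>Medians of real numbers\<close>

text \<open>Two obstacles shape the proof. The constant K is fixed: \<sigma> is bounded below only
  by functions that satisfy the contraction inequalities with this very K, so contractions must be
  combined without any loss. Gluing across a gap of 3K, along a geodesic of d, achieves this.
  Medians of points may lose a bounded amount each time, but Helly's argument pays K per halfspace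
  and so reaches only families of bounded size. Infinitely many halfspaces must therefore be reduced
  to boundedly many, and this is where the rank enters.

  The second obstacle is that contractions know nothing about domains. A cube found from crossing
  halfspaces has arbitrary vertices, and several of its directions may be mixed in one domain. It is
  straightened by lattice operations built from medians, after which at most one direction is
  visible in any real function that coarsely preserves medians. Contractions are such functions, and
  so are Gromov products in all the hyperbolic spaces of the hierarchy.\<close>

lemma real_median_uminus: "real_median (- a) (- b) (- c) = - real_median a b c"
  by (simp add: real_median_def min_def max_def)

lemma real_median_diff_const: "real_median (a - t) (b - t) (c - t) = real_median a b c - t"
  by (simp add: real_median_def min_def max_def)

lemma real_median_max: "real_median (max a t) (max b t) (max c t) = max (real_median a b c) t"
  by (simp add: real_median_def min_def max_def)

lemma real_median_min: "real_median (min a t) (min b t) (min c t) = min (real_median a b c) t"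
  by (simp add: real_median_def min_def max_def)

lemma real_median_lipschitz:
  assumes "\<bar>a - a'\<bar> \<le> r" "\<bar>b - b'\<bar> \<le> r" "\<bar>c - c'\<bar> \<le> r"
  shows "\<bar>real_median a b c - real_median a' b' c'\<bar> \<le> r"
  using assms unfolding real_median_def min_def max_def by (auto split: if_splits)

lemma real_median_le:
  assumes "a \<le> t \<and> b \<le> t \<or> a \<le> t \<and> c \<le> t \<or> b \<le> t \<and> c \<le> t"
  shows "real_median a b c \<le> t"
  using assms unfolding real_median_def min_def max_def by auto

lemma real_median_ge:
  assumes "a \<ge> t \<and> b \<ge> t \<or> a \<ge> t \<and> c \<ge> t \<or> b \<ge> t \<and> c \<ge> t"
  shows "real_median a b c \<ge> t"
  using assms unfolding real_median_def min_def max_def by auto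

lemma real_median_approx:
  assumes "min a b - r \<le> m" "m \<le> max a b + r" "min b c - r \<le> m" "m \<le> max b c + r"
    "min a c - r \<le> m" "m \<le> max a c + r"
  shows "\<bar>m - real_median a b c\<bar> \<le> r"
  using assms unfolding real_median_def min_def max_def by (auto split: if_splits)

lemma real_median_join:
  "z \<le> v \<Longrightarrow> v \<le> u \<Longrightarrow> real_median u v w = max v (min u w)"
  "v \<le> u \<Longrightarrow> real_median u w v = max v (min u w)"
  "z \<le> v \<Longrightarrow> real_median z w v = max z (min w v)"
  unfolding real_median_def min_def max_def by auto

text \<open>\<open>P\<close> is arbitrary, so there is no continuity to use: t is taken at or just
  below the supremum of the points where \<open>P\<close> holds, t' just above it. If D is too close
  for that, t' is D, where \<open>P\<close> may still hold.\<close>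

lemma exists_transition:
  fixes D \<epsilon> :: real
  assumes "P 0" "0 \<le> D" "0 < \<epsilon>"
  shows "\<exists>t\<in>{0..D}. \<exists>t'\<in>{0..D}. P t \<and> \<bar>t - t'\<bar> \<le> \<epsilon> \<and> (\<not> P t' \<or> t' = D)"
proof -
  define S where "S = {t\<in>{0..D}. P t}"
  have S: "0 \<in> S" "bdd_above S"
    using assms by (auto simp: S_def intro!: bdd_aboveI[of _ D])
  then obtain t where t: "t \<in> S" "Sup S - \<epsilon>/2 < t"
    using less_cSup_iff[of S "Sup S - \<epsilon>/2"] \<open>0 < \<epsilon>\<close> by auto
  have ts: "t \<le> Sup S" using cSup_upper[OF t(1) S(2)] .
  define t' where "t' = min D (Sup S + \<epsilon>/2)"
  have tD: "t \<in> {0..D}" "P t" using t by (auto simp: S_def)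
  have "t' \<in> {0..D}" using ts tD assms by (auto simp: t'_def)
  moreover have "\<bar>t - t'\<bar> \<le> \<epsilon>"
    using t ts tD \<open>0 < \<epsilon>\<close> unfolding t'_def by (auto simp: min_def abs_if)
  moreover have "\<not> P t' \<or> t' = D"
  proof (rule ccontr)
    assume "\<not> (\<not> P t' \<or> t' = D)"
    then have "t' \<in> S" "t' = Sup S + \<epsilon>/2"
      using \<open>t' \<in> {0..D}\<close> by (auto simp: S_def t'_def min_def split: if_splits)
    then show False using cSup_upper[of t' S] S \<open>0 < \<epsilon>\<close> by auto
  qed
  ultimately show ?thesis using tD by blast
qed


section \<open>Gromov products in hyperbolic spaces\<close>

definition gromov_product :: "('a \<Rightarrow> 'a \<Rightarrow> real) \<Rightarrow> 'a \<Rightarrow> 'a \<Rightarrow> 'a \<Rightarrow> real" where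
  "gromov_product d w x y = (d w x + d w y - d x y) / 2"

definition four_point :: "real \<Rightarrow> 'a set \<Rightarrow> ('a \<Rightarrow> 'a \<Rightarrow> real) \<Rightarrow> bool" where
  "four_point \<delta> M d \<longleftrightarrow> (\<forall>w\<in>M. \<forall>x\<in>M. \<forall>y\<in>M. \<forall>z\<in>M.
     min (gromov_product d w x y) (gromov_product d w y z) - \<delta> \<le> gromov_product d w x z)"

context Metric_space
begin

lemma geodesic_segmentD:
  assumes "geodesic_segment M d x y A" "p \<in> A" "x \<in> M" "y \<in> M"
  shows "p \<in> M" "d x p + d p y = d x y"
proof -
  obtain f where f: "f 0 = x" "f (d x y) = y" "f ` {0..d x y} \<subseteq> M"
      "\<And>s t. s \<in> {0..d x y} \<Longrightarrow> t \<in> {0..d x y} \<Longrightarrow> d (f s) (f t) = \<bar>s - t\<bar>" "A = f ` {0..d x y}"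
    using assms(1) unfolding geodesic_segment_def by blast
  then obtain s where s: "s \<in> {0..d x y}" "p = f s" using assms(2) by auto
  show "p \<in> M" using s f(3) by auto
  have "d x p = s" using f(4)[of 0 s] s f(1) by auto
  moreover have "d p y = d x y - s" using f(4)[of s "d x y"] s f(2) by auto
  ultimately show "d x p + d p y = d x y" by simp
qed

lemma geodesic_segment_endpoints:
  assumes "geodesic_segment M d x y A" "x \<in> M" "y \<in> M"
  shows "x \<in> A" "y \<in> A"
proof -
  obtain f where f: "f 0 = x" "f (d x y) = y" "A = f ` {0..d x y}"
    using assms unfolding geodesic_segment_def by blast
  show "x \<in> A" unfolding f(3) by (rule image_eqI[of _ _ 0]) (use f in auto)
  show "y \<in> A" unfolding f(3) by (rule image_eqI[of _ _ "d x y"]) (use f in auto)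
qed

lemma gromov_product_le_dist:
  assumes "geodesic_segment M d x y A" "p \<in> A" "x \<in> M" "y \<in> M" "w \<in> M"
  shows "gromov_product d w x y \<le> d w p"
proof -
  note p = geodesic_segmentD[OF assms(1-4)]
  have "d w x \<le> d w p + d p x" "d w y \<le> d w p + d p y"
    by (intro triangle p assms)+
  then show ?thesis using p by (simp add: gromov_product_def commute)
qed

text \<open>Where the side close to [x, y] changes from [x, w] to [y, w], a point is close to both
  and almost realises the Gromov product. The jump of at most 1 between the two parameters gives the
  summand 1.\<close>

lemma dist_le_gromov_product:
  assumes "hyperbolic_space E M d" "geodesic_space M d" "x \<in> M" "y \<in> M" "w \<in> M"
    and A: "geodesic_segment M d x y A"
  shows "\<exists>p\<in>A. d w p \<le> gromov_product d w x y + 2 * E + 1"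
proof -
  obtain B C where B: "geodesic_segment M d y w B" and C: "geodesic_segment M d x w C"
    using assms unfolding geodesic_space_def by blast
  obtain f where f: "f 0 = x" "f (d x y) = y" "f ` {0..d x y} \<subseteq> M"
      "\<And>s t. s \<in> {0..d x y} \<Longrightarrow> t \<in> {0..d x y} \<Longrightarrow> d (f s) (f t) = \<bar>s - t\<bar>" "A = f ` {0..d x y}"
    using A unfolding geodesic_segment_def by blast
  have slim: "\<exists>q\<in>B \<union> C. d p q \<le> E" if "p \<in> A" for p
    using assms(1,3-5) A B C that unfolding hyperbolic_space_def by blast
  have "x \<in> A" using f by (auto intro: rev_image_eqI)
  then obtain q0 where "d x q0 \<le> E" using slim by blast
  then have E0: "E \<ge> 0" using nonneg[of x q0] by linarith
  define P where "P = (\<lambda>t. \<exists>q\<in>C. d (f t) q \<le> E)"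
  have "P 0" unfolding P_def f(1)
    using geodesic_segment_endpoints(1)[OF C] assms E0 by (intro bexI[of _ x]) auto
  then obtain t t' where t: "t \<in> {0..d x y}" "t' \<in> {0..d x y}" "P t" "\<bar>t - t'\<bar> \<le> 1" "\<not> P t' \<or> t' = d x y"
    using exists_transition[of P "d x y" 1] nonneg[of x y] by (meson zero_less_one)
  have M: "f t \<in> M" "f t' \<in> M" using f(3) t by auto
  have "\<exists>q\<in>B. d (f t') q \<le> E"
  proof (cases "t' = d x y")
    case True
    then show ?thesis using f(2) geodesic_segment_endpoints(1)[OF B] assms E0
      by (intro bexI[of _ y]) auto
  next
    case False
    then have "\<not> P t'" using t by blast
    then show ?thesis using slim[of "f t'"] f(5) t(2) unfolding P_def by auto
  qed
  then obtain q where q: "q \<in> B" "d (f t') q \<le> E" by blast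
  obtain q' where q': "q' \<in> C" "d (f t) q' \<le> E" using t(3) unfolding P_def by blast
  note qB = geodesic_segmentD[OF B q(1) assms(4,5)]
  note qC = geodesic_segmentD[OF C q'(1) assms(3,5)]
  have tt: "d (f t) (f t') \<le> 1" using f(4) t by auto
  have 1: "d (f t) q \<le> E + 1" using triangle[OF M qB(1)] tt q(2) by linarith
  have "d w (f t) \<le> d w q + d q (f t)" "d y (f t) \<le> d y q + d q (f t)"
     "d w (f t) \<le> d w q' + d q' (f t)" "d x (f t) \<le> d x q' + d q' (f t)"
    by (intro triangle M qB qC assms)+
  moreover have "d x (f t) + d (f t) y = d x y"
    using geodesic_segmentD(2)[OF A _ assms(3,4), of "f t"] f(5) t(1) by auto
  ultimately have "d w (f t) \<le> gromov_product d w x y + 2 * E + 1"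
    unfolding gromov_product_def using 1 q'(2) qB qC
    by (simp add: commute[of q w] commute[of q' w] commute[of q "f t"] commute[of q' "f t"]
        commute[of y w] commute[of x w] commute[of y "f t"] commute[of w "f t"] field_simps)
  then show ?thesis using f(5) t(1) by blast
qed

text \<open>A point of [x, z] that almost realises the Gromov product is within E of a second side
  of the triangle x, z, y, and w is at least as far from that side as the Gromov product of its
  ends.\<close>

lemma hyperbolic_imp_four_point:
  assumes "hyperbolic_space E M d" "geodesic_space M d"
  shows "four_point (3 * E + 1) M d"
  unfolding four_point_def
proof (intro ballI)
  fix w x y z assume M: "w \<in> M" "x \<in> M" "y \<in> M" "z \<in> M"
  obtain A B C where A: "geodesic_segment M d x z A" and B: "geodesic_segment M d z y B"
    and C: "geodesic_segment M d x y C"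
    using assms M unfolding geodesic_space_def by blast
  obtain p where p: "p \<in> A" "d w p \<le> gromov_product d w x z + 2 * E + 1"
    using dist_le_gromov_product[OF assms M(2,4,1) A] by blast
  obtain q where q: "q \<in> B \<union> C" "d p q \<le> E"
    using assms(1) M A B C p unfolding hyperbolic_space_def by blast
  have pM: "p \<in> M" using geodesic_segmentD(1)[OF A p(1)] M by blast
  have qM: "q \<in> M" using geodesic_segmentD(1)[OF B _ M(4,3)] geodesic_segmentD(1)[OF C _ M(2,3)] q by blast
  have "min (gromov_product d w x y) (gromov_product d w y z) \<le> d w q"
    using gromov_product_le_dist[OF B _ M(4,3,1)] gromov_product_le_dist[OF C _ M(2,3,1)] q(1)
    by (auto simp: gromov_product_def commute add.commute min_le_iff_disj)
  also have "\<dots> \<le> d w p + d p q" by (intro triangle M pM qM)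
  finally show "min (gromov_product d w x y) (gromov_product d w y z) - (3 * E + 1) \<le> gromov_product d w x z"
    using p q by linarith
qed

text \<open>Behind it is the identity (a|b)_u + d(u, m) = (m|a)_u + (m|b)_u + e, where 2e is the
  excess d(a, m) + d(m, b) - d(a, b). If (m|v)_u were too small, the four point inequality would
  make (m|a)_u and (m|b)_u small as well, although (a|b)_u is large.\<close>

lemma gromov_product_between:
  assumes fp: "four_point \<delta> M d" and M: "u \<in> M" "v \<in> M" "a \<in> M" "b \<in> M" "m \<in> M"
    and m: "d a m + d m b \<le> d a b + 2 * r"
  shows "min (gromov_product d u a v) (gromov_product d u b v) - (r + 3 * \<delta>) \<le> gromov_product d u m v"
proof (rule ccontr)
  let ?g = "gromov_product d"
  assume "\<not> ?thesis"
  then have c: "?g u m v < min (?g u a v) (?g u b v) - (r + 3 * \<delta>)" by simp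
  have "min (?g u a m) (?g u m v) - \<delta> \<le> ?g u a v" "min (?g u m a) (?g u a v) - \<delta> \<le> ?g u m v"
    "min (?g u m b) (?g u b v) - \<delta> \<le> ?g u m v" "min (?g u a v) (?g u v b) - \<delta> \<le> ?g u a b"
    "min (?g u m v) (?g u v m) - \<delta> \<le> ?g u m m"
    using fp M unfolding four_point_def by blast+
  moreover have "?g u v b = ?g u b v" "?g u v m = ?g u m v" "?g u a m = ?g u m a"
    by (simp_all add: gromov_product_def commute)
  moreover have "?g u m v \<le> d u m" "0 \<le> r" "0 \<le> \<delta>"
  proof -
    have "d u v \<le> d u m + d m v" "d a b \<le> d a m + d m b" by (intro triangle M)+
    then show "?g u m v \<le> d u m" "0 \<le> r" using m by (auto simp: gromov_product_def)
    have "min (?g u u u) (?g u u u) - \<delta> \<le> ?g u u u"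
      using fp M unfolding four_point_def by blast
    then show "0 \<le> \<delta>" by simp
  qed
  moreover have "?g u a b + d u m - ?g u m a - ?g u m b \<le> r"
    using m by (simp add: gromov_product_def commute field_simps)
  ultimately show False using c by (auto simp: min_def split: if_splits)
qed

lemma gromov_product_flip:
  "gromov_product d u m v = d u v - gromov_product d v m u"
  by (simp add: gromov_product_def commute field_simps)

lemma gromov_product_between':
  assumes "four_point \<delta> M d" "u \<in> M" "v \<in> M" "a \<in> M" "b \<in> M" "m \<in> M"
    and "d a m + d m b \<le> d a b + 2 * r"
  shows "gromov_product d u m v \<le> max (gromov_product d u a v) (gromov_product d u b v) + (r + 3 * \<delta>)"
  using gromov_product_between[OF assms(1,3,2,4-7)]
  by (simp add: gromov_product_flip[of u _ v] min_def max_def split: if_splits)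

lemma gromov_product_lipschitz:
  assumes "u \<in> M" "v \<in> M" "p \<in> M" "q \<in> M"
  shows "\<bar>gromov_product d u p v - gromov_product d u q v\<bar> \<le> d p q"
proof -
  have "d u p \<le> d u q + d q p" "d u q \<le> d u p + d p q" "d p v \<le> d p q + d q v" "d q v \<le> d q p + d p v"
    by (intro triangle assms)+
  then show ?thesis by (simp add: gromov_product_def commute abs_le_iff field_simps)
qed

lemma coarse_centre_between:
  assumes "coarse_centre r M d a b c m" "geodesic_space M d" "a \<in> M" "b \<in> M" "c \<in> M"
  shows "d a m + d m b \<le> d a b + 2 * r" "d b m + d m c \<le> d b c + 2 * r" "d a m + d m c \<le> d a c + 2 * r"
proof -
  have m: "m \<in> M" using assms unfolding coarse_centre_def by blast
  have *: "d x m + d m y \<le> d x y + 2 * r"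
    if xy: "x \<in> M" "y \<in> M" and near: "\<And>A. geodesic_segment M d x y A \<Longrightarrow> \<exists>q\<in>A. d m q \<le> r" for x y
  proof -
    obtain A where A: "geodesic_segment M d x y A"
      using assms(2) xy unfolding geodesic_space_def by meson
    obtain q where q: "q \<in> A" "d m q \<le> r" using near[OF A] by blast
    note qA = geodesic_segmentD[OF A q(1) xy]
    have "d x m \<le> d x q + d q m" "d m y \<le> d m q + d q y" by (intro triangle xy m qA)+
    then show ?thesis using qA q by (simp add: commute[of q m])
  qed
  show "d a m + d m b \<le> d a b + 2 * r" "d b m + d m c \<le> d b c + 2 * r" "d a m + d m c \<le> d a c + 2 * r"
    by (rule *; use assms in \<open>simp add: coarse_centre_def\<close>)+
qed

text \<open>Gromov products against fixed u and v are real coordinates in which a coarse centre is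
  the median; they do for the domains what contractions do for X.\<close>

lemma gromov_product_coarse_centre:
  assumes "coarse_centre r M d a b c m" "geodesic_space M d" "four_point \<delta> M d"
    "a \<in> M" "b \<in> M" "c \<in> M" "u \<in> M" "v \<in> M"
  shows "\<bar>gromov_product d u m v -
      real_median (gromov_product d u a v) (gromov_product d u b v) (gromov_product d u c v)\<bar> \<le> r + 3 * \<delta>"
proof -
  have m: "m \<in> M" using assms unfolding coarse_centre_def by blast
  note b = coarse_centre_between[OF assms(1,2,4,5,6)]
  show ?thesis
    by (intro real_median_approx gromov_product_between gromov_product_between' b m assms)
qed

text \<open>The four points are the corners of a coarse rectangle; in a hyperbolic space it is degenerate.\<close>

lemma thin_rectangle:
  assumes fp: "four_point \<delta> M d" and M: "w \<in> M" "x \<in> M" "y \<in> M" "z \<in> M"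
    and rect: "\<And>u v. u \<in> M \<Longrightarrow> v \<in> M \<Longrightarrow>
      (let \<Psi> = (\<lambda>p. gromov_product d u p v) in
         \<bar>\<Psi> x - \<Psi> w\<bar> \<le> C \<and> \<bar>\<Psi> z - \<Psi> y\<bar> \<le> C \<or> \<bar>\<Psi> y - \<Psi> w\<bar> \<le> C \<and> \<bar>\<Psi> z - \<Psi> x\<bar> \<le> C)"
    and far: "d w x > 2 * C + \<delta>"
  shows "d w y \<le> 2 * C + \<delta>" "d x z \<le> 4 * C + \<delta>"
proof -
  let ?g = "gromov_product d"
  have self: "?g p p q = 0" "?g p q q = d p q" if "p \<in> M" "q \<in> M" for p q
    using that by (auto simp: gromov_product_def)
  have C0: "0 \<le> C"
    using rect[OF M(1,1)] by (auto simp: Let_def intro: order_trans[OF abs_ge_zero])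
  have "min (?g w w w) (?g w w w) - \<delta> \<le> ?g w w w"
    using fp M unfolding four_point_def by blast
  then have \<delta>0: "0 \<le> \<delta>" by simp
  \<comment> \<open>In the coordinate from w to x these two points are far apart, which rules out
    the first alternative.\<close>
  have 1: "\<bar>?g w y x\<bar> \<le> C" "\<bar>?g w z x - d w x\<bar> \<le> C"
    using rect[OF M(1,2)] far C0 \<delta>0 self M by (auto simp: Let_def)
  show le: "d w y \<le> 2 * C + \<delta>"
  proof (rule ccontr)
    assume n: "\<not> ?thesis"
    \<comment> \<open>If y were far from w as well, z would lie both in the direction of x and in
      that of y as seen from w, so these directions would agree, contrary to
      \<open>1\<close>.\<close>
    have "\<bar>?g w z y - d w y\<bar> \<le> C"
      using rect[OF M(1,3)] n C0 \<delta>0 self M by (auto simp: Let_def)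
    moreover have "min (?g w y z) (?g w z x) - \<delta> \<le> ?g w y x"
      using fp M unfolding four_point_def by blast
    moreover have "?g w y z = ?g w z y" by (simp add: gromov_product_def commute)
    ultimately show False using 1 n far by (auto simp: min_def split: if_splits)
  qed
  have "\<bar>?g x y z - ?g x w z\<bar> \<le> d w y"
    using gromov_product_lipschitz[of x z y w] M by (simp add: commute)
  then show "d x z \<le> 4 * C + \<delta>"
    using rect[OF M(2,4)] C0 \<delta>0 self M le by (auto simp: Let_def abs_le_iff)
qed

end

section \<open>Disjoint joins in an interval\<close>

text \<open>Separated from the Lipschitz condition because the straightening is applied both to
  contractions, with error K, and to Gromov products in the domains, with another error.\<close>

definition median_hom ::
  "real \<Rightarrow> 'a set \<Rightarrow> ('a \<Rightarrow> 'a \<Rightarrow> 'a \<Rightarrow> 'a) \<Rightarrow> ('a \<Rightarrow> real) \<Rightarrow> bool" where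
  "median_hom \<kappa> M \<mu> \<Psi> \<longleftrightarrow>
     (\<forall>x\<in>M. \<forall>y\<in>M. \<forall>z\<in>M. \<bar>\<Psi> (\<mu> x y z) - real_median (\<Psi> x) (\<Psi> y) (\<Psi> z)\<bar> \<le> \<kappa>)"

lemma median_homD:
  "median_hom \<kappa> M \<mu> \<Psi> \<Longrightarrow> x \<in> M \<Longrightarrow> y \<in> M \<Longrightarrow> z \<in> M \<Longrightarrow>
     \<bar>\<Psi> (\<mu> x y z) - real_median (\<Psi> x) (\<Psi> y) (\<Psi> z)\<bar> \<le> \<kappa>"
  by (simp add: median_hom_def)

text \<open>In the lattice \<open>[z, u]\<close>, with join \<open>m u\<close> and meet \<open>m z\<close>, these are the join of the first \<open>k\<close>
  elements \<open>e i\<close> and the join of their pairwise meets. On the real line the latter is the second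
  largest element.\<close>

primrec join_upto :: "('a \<Rightarrow> 'a \<Rightarrow> 'a \<Rightarrow> 'a) \<Rightarrow> 'a \<Rightarrow> 'a \<Rightarrow> (nat \<Rightarrow> 'a) \<Rightarrow> nat \<Rightarrow> 'a" where
  "join_upto m z u e 0 = z"
| "join_upto m z u e (Suc k) = m u (join_upto m z u e k) (e k)"

primrec meets_upto :: "('a \<Rightarrow> 'a \<Rightarrow> 'a \<Rightarrow> 'a) \<Rightarrow> 'a \<Rightarrow> 'a \<Rightarrow> (nat \<Rightarrow> 'a) \<Rightarrow> nat \<Rightarrow> 'a" where
  "meets_upto m z u e 0 = z"
| "meets_upto m z u e (Suc k) = m u (meets_upto m z u e k) (m z (e k) (join_upto m z u e k))"

lemma upto_closed:
  assumes "\<And>x y z. x \<in> M \<Longrightarrow> y \<in> M \<Longrightarrow> z \<in> M \<Longrightarrow> \<mu> x y z \<in> M"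
    and "z \<in> M" "u \<in> M" "\<And>i. i < k \<Longrightarrow> e i \<in> M"
  shows "join_upto \<mu> z u e k \<in> M" "meets_upto \<mu> z u e k \<in> M"
  using assms(4) by (induction k) (auto intro!: assms(1-3))

text \<open>The real median is 1-Lipschitz for the supremum norm, so the errors of its arguments do
  not add up. A step of the join applies \<mu> once; a step of the second recursion applies it
  twice, for a meet and a join.\<close>

lemma median_hom_upto:
  assumes \<mu>: "\<And>x y z. x \<in> M \<Longrightarrow> y \<in> M \<Longrightarrow> z \<in> M \<Longrightarrow> \<mu> x y z \<in> M"
    and zu: "z \<in> M" "u \<in> M" and "\<And>i. i < k \<Longrightarrow> e i \<in> M" and \<Psi>: "median_hom \<kappa> M \<mu> \<Psi>"
  shows "\<bar>\<Psi> (join_upto \<mu> z u e k) - join_upto real_median (\<Psi> z) (\<Psi> u) (\<lambda>i. \<Psi> (e i)) k\<bar> \<le> real k * \<kappa>"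
    "\<bar>\<Psi> (meets_upto \<mu> z u e k) - meets_upto real_median (\<Psi> z) (\<Psi> u) (\<lambda>i. \<Psi> (e i)) k\<bar> \<le> 2 * real k * \<kappa>"
proof -
  have \<kappa>: "0 \<le> \<kappa>" using median_homD[OF \<Psi> zu(1) zu(1) zu(1)] by linarith
  have "\<bar>\<Psi> (join_upto \<mu> z u e k) - join_upto real_median (\<Psi> z) (\<Psi> u) (\<lambda>i. \<Psi> (e i)) k\<bar> \<le> real k * \<kappa> \<and>
    \<bar>\<Psi> (meets_upto \<mu> z u e k) - meets_upto real_median (\<Psi> z) (\<Psi> u) (\<lambda>i. \<Psi> (e i)) k\<bar> \<le> 2 * real k * \<kappa>"
    using assms(4)
  proof (induction k)
    case (Suc k)
    let ?w = "join_upto \<mu> z u e k" and ?o = "meets_upto \<mu> z u e k"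
    let ?wr = "join_upto real_median (\<Psi> z) (\<Psi> u) (\<lambda>i. \<Psi> (e i)) k"
      and ?or = "meets_upto real_median (\<Psi> z) (\<Psi> u) (\<lambda>i. \<Psi> (e i)) k"
    have IH: "\<bar>\<Psi> ?w - ?wr\<bar> \<le> real k * \<kappa>" "\<bar>\<Psi> ?o - ?or\<bar> \<le> 2 * real k * \<kappa>" using Suc by auto
    have M: "?w \<in> M" "?o \<in> M" "e k \<in> M"
      using upto_closed[where e = e and k = k, OF \<mu> zu] Suc.prems by auto
    have k: "0 \<le> real k * \<kappa>" using \<kappa> by simp
    have "\<bar>real_median (\<Psi> u) (\<Psi> ?w) (\<Psi> (e k)) - real_median (\<Psi> u) ?wr (\<Psi> (e k))\<bar> \<le> real k * \<kappa>"
      by (rule real_median_lipschitz) (use IH k in auto)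
    then have 1: "\<bar>\<Psi> (\<mu> u ?w (e k)) - real_median (\<Psi> u) ?wr (\<Psi> (e k))\<bar> \<le> real (Suc k) * \<kappa>"
      using median_homD[OF \<Psi> zu(2) M(1) M(3)] by (simp add: algebra_simps)
    have "\<bar>real_median (\<Psi> z) (\<Psi> (e k)) (\<Psi> ?w) - real_median (\<Psi> z) (\<Psi> (e k)) ?wr\<bar> \<le> real k * \<kappa>"
      by (rule real_median_lipschitz) (use IH k in auto)
    then have 2: "\<bar>\<Psi> (\<mu> z (e k) ?w) - real_median (\<Psi> z) (\<Psi> (e k)) ?wr\<bar> \<le> \<kappa> + real k * \<kappa>"
      using median_homD[OF \<Psi> zu(1) M(3) M(1)] by linarith
    have "\<bar>real_median (\<Psi> u) (\<Psi> ?o) (\<Psi> (\<mu> z (e k) ?w)) -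
        real_median (\<Psi> u) ?or (real_median (\<Psi> z) (\<Psi> (e k)) ?wr)\<bar> \<le> \<kappa> + 2 * real k * \<kappa>"
      by (rule real_median_lipschitz) (use IH k 2 \<kappa> in auto)
    then have "\<bar>\<Psi> (\<mu> u ?o (\<mu> z (e k) ?w)) -
        real_median (\<Psi> u) ?or (real_median (\<Psi> z) (\<Psi> (e k)) ?wr)\<bar> \<le> 2 * real (Suc k) * \<kappa>"
      using median_homD[OF \<Psi> zu(2) M(2) \<mu>[OF zu(1) M(3) M(1)]] by (simp add: algebra_simps)
    then show ?case using 1 by simp
  qed auto
  then show "\<bar>\<Psi> (join_upto \<mu> z u e k) - join_upto real_median (\<Psi> z) (\<Psi> u) (\<lambda>i. \<Psi> (e i)) k\<bar> \<le> real k * \<kappa>"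
    "\<bar>\<Psi> (meets_upto \<mu> z u e k) - meets_upto real_median (\<Psi> z) (\<Psi> u) (\<lambda>i. \<Psi> (e i)) k\<bar> \<le> 2 * real k * \<kappa>"
    by auto
qed

text \<open>A coordinate may reverse the order and put z above u; a change of sign reduces this case
  to the other.\<close>

lemma upto_real_uminus:
  "join_upto real_median (- z) (- u) (\<lambda>i. - e i) k = - join_upto real_median z u e k"
  "meets_upto real_median (- z) (- u) (\<lambda>i. - e i) k = - meets_upto real_median z u e k"
  by (induction k) (simp_all add: real_median_uminus)

lemma upto_real:
  fixes z u :: real
  assumes zu: "z \<le> u"
  shows "z \<le> meets_upto real_median z u e k" "meets_upto real_median z u e k \<le> join_upto real_median z u e k"
    "join_upto real_median z u e k \<le> u"
    "i < j \<Longrightarrow> j < k \<Longrightarrow> min u (min (e i) (e j)) \<le> meets_upto real_median z u e k"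
proof -
  let ?w = "join_upto real_median z u e" and ?o = "meets_upto real_median z u e"
  have *: "z \<le> ?o k \<and> ?o k \<le> ?w k \<and> ?w k \<le> u \<and> (\<forall>i<k. min u (e i) \<le> ?w k) \<and>
      (\<forall>j<k. \<forall>i<j. min u (min (e i) (e j)) \<le> ?o k)"
  proof (induction k)
    case (Suc k)
    have w: "?w (Suc k) = max (?w k) (min u (e k))" and
      o: "?o (Suc k) = max (?o k) (min u (max z (min (e k) (?w k))))"
      using Suc zu by (simp_all add: real_median_join[of z])
    have "min u (min (e i) (e j)) \<le> ?o (Suc k)" if "j < Suc k" "i < j" for i j
    proof (cases "j = k")
      case True
      then have "min u (e i) \<le> ?w k" using Suc that by auto
      then show ?thesis using True unfolding o by (auto simp: min_def max_def split: if_splits)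
    next
      case False
      then have "min u (min (e i) (e j)) \<le> ?o k" using Suc that by auto
      then show ?thesis unfolding o by (rule order_trans) auto
    qed
    moreover have "min u (e i) \<le> ?w (Suc k)" if "i < Suc k" for i
      using Suc that unfolding w by (cases "i = k") (auto simp: le_max_iff_disj)
    moreover have "z \<le> ?o (Suc k)" "?o (Suc k) \<le> ?w (Suc k)" "?w (Suc k) \<le> u"
      using Suc zu unfolding w o by (auto simp: min_def max_def)
    ultimately show ?case by blast
  qed (use zu in auto)
  show "z \<le> ?o k" "?o k \<le> ?w k" "?w k \<le> u"
    "i < j \<Longrightarrow> j < k \<Longrightarrow> min u (min (e i) (e j)) \<le> ?o k"
    using * by blast+
qed

text \<open>The join stays below s until \<open>e k\<close> enters it, \<open>e k\<close> itself
  contributes only its meet with that join, and all later elements are at most s.\<close>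

lemma meets_upto_real_le:
  fixes z u s :: real
  assumes "z \<le> s" "s \<le> u" "\<And>i. i < n \<Longrightarrow> i \<noteq> k \<Longrightarrow> e i \<le> s"
  shows "meets_upto real_median z u e n \<le> s"
proof -
  let ?w = "join_upto real_median z u e" and ?o = "meets_upto real_median z u e"
  have "?o m \<le> s \<and> (m \<le> k \<longrightarrow> ?w m \<le> s)" if "m \<le> n" for m
    using that
  proof (induction m)
    case (Suc m)
    have zu: "z \<le> u" using assms by linarith
    have w: "?w (Suc m) = max (?w m) (min u (e m))" and
      o: "?o (Suc m) = max (?o m) (min u (max z (min (e m) (?w m))))"
      using upto_real(1,2,3)[OF zu, of e m] by (simp_all add: real_median_join[of z])
    have "e m \<le> s \<or> m = k" using assms(3) Suc by auto
    then show ?case using Suc assms unfolding w o by (auto simp: min_le_iff_disj)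
  qed (use assms in auto)
  then show ?thesis by blast
qed

text \<open>Since \<open>o'\<close> already lies above the meet of \<open>e i\<close> and
  \<open>e j\<close>, distributivity makes \<open>o'\<close> the meet of their joins with
  \<open>o'\<close>. In a chain one of two elements equals their meet.\<close>

lemma disjoint_joins_real:
  fixes z u :: real and e :: "nat \<Rightarrow> real" and n :: nat
  defines "o' \<equiv> meets_upto real_median z u e n"
  assumes ij: "i < n" "j < n" "i \<noteq> j"
  defines "Ei \<equiv> real_median u (e i) o'" and "Ej \<equiv> real_median u (e j) o'"
  shows "Ei = o' \<and> real_median u Ei Ej = Ej \<or> Ej = o' \<and> real_median u Ei Ej = Ei"
proof -
  have main: "real_median u (e i) p = p \<and> real_median u (real_median u (e i) p) (real_median u (e j) p) = real_median u (e j) p \<or>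
     real_median u (e j) p = p \<and> real_median u (real_median u (e i) p) (real_median u (e j) p) = real_median u (e i) p"
    if zu: "z \<le> u" and p: "p = meets_upto real_median z u e n" for z u :: real and e p
  proof -
    have pu: "p \<le> u" using upto_real(2,3)[OF zu, of e n] p by linarith
    have "min u (min (e i) (e j)) \<le> p"
      using upto_real(4)[OF zu, of i j n e] upto_real(4)[OF zu, of j i n e] ij p
      by (cases "i < j") (auto simp: min.commute)
    then show ?thesis using pu unfolding real_median_def by (auto simp: min_def max_def split: if_splits)
  qed
  show ?thesis
  proof (cases "z \<le> u")
    case True
    then show ?thesis unfolding Ei_def Ej_def o'_def by (rule main[OF _ refl])
  next
    case False
    then show ?thesis
      using main[of "- z" "- u" "- o'" "\<lambda>i. - e i"] unfolding Ei_def Ej_def o'_def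
      by (simp add: upto_real_uminus real_median_uminus)
  qed
qed

text \<open>With \<open>o'\<close> the join of the pairwise meets, \<open>e' i\<close> the join of
  \<open>e i\<close> and \<open>o'\<close>, and \<open>c i j\<close> the join of \<open>e' i\<close>
  and \<open>e' j\<close>, the points \<open>o'\<close>, \<open>e' i\<close>, \<open>c i j\<close>,
  \<open>e' j\<close> form a coarse rectangle. They are chosen before \<Psi> and so serve all
  coordinates at once. The last property says that direction k survives the straightening.\<close>

lemma disjoint_joins:
  fixes n :: nat
  assumes \<mu>: "\<And>x y z. x \<in> M \<Longrightarrow> y \<in> M \<Longrightarrow> z \<in> M \<Longrightarrow> \<mu> x y z \<in> M"
    and zu: "z \<in> M" "u \<in> M" and e: "\<And>i. i < n \<Longrightarrow> e i \<in> M"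
  defines "R \<equiv> 4 * real n + 4"
  obtains o' e' c where "o' \<in> M" "\<And>i. i < n \<Longrightarrow> e' i \<in> M"
    "\<And>i j. i < n \<Longrightarrow> j < n \<Longrightarrow> c i j \<in> M"
    "\<And>\<kappa> \<Psi> i j. median_hom \<kappa> M \<mu> \<Psi> \<Longrightarrow> i < n \<Longrightarrow> j < n \<Longrightarrow> i \<noteq> j \<Longrightarrow>
       \<bar>\<Psi> (e' i) - \<Psi> o'\<bar> \<le> R * \<kappa> \<and> \<bar>\<Psi> (c i j) - \<Psi> (e' j)\<bar> \<le> R * \<kappa> \<or>
       \<bar>\<Psi> (e' j) - \<Psi> o'\<bar> \<le> R * \<kappa> \<and> \<bar>\<Psi> (c i j) - \<Psi> (e' i)\<bar> \<le> R * \<kappa>"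
    "\<And>\<kappa> \<Psi> k s t. median_hom \<kappa> M \<mu> \<Psi> \<Longrightarrow> k < n \<Longrightarrow> s \<le> t \<Longrightarrow> \<Psi> z \<le> s \<Longrightarrow> t \<le> \<Psi> u \<Longrightarrow>
       (\<And>i. i < n \<Longrightarrow> i \<noteq> k \<Longrightarrow> \<Psi> (e i) \<le> s) \<Longrightarrow> t \<le> \<Psi> (e k) \<Longrightarrow> \<Psi> (e' k) - \<Psi> o' \<ge> t - s - R * \<kappa>"
proof -
  define o' where "o' = meets_upto \<mu> z u e n"
  define e' where "e' = (\<lambda>i. \<mu> u (e i) o')"
  define c where "c = (\<lambda>i j. \<mu> u (e' i) (e' j))"
  have o': "o' \<in> M" unfolding o'_def by (intro upto_closed \<mu> zu e)
  have e': "e' i \<in> M" if "i < n" for i unfolding e'_def by (intro \<mu> zu o' e that)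
  have c: "c i j \<in> M" if "i < n" "j < n" for i j unfolding c_def by (intro \<mu> zu e' that)
  have err: "0 \<le> \<kappa>" "\<bar>\<Psi> o' - meets_upto real_median (\<Psi> z) (\<Psi> u) (\<lambda>i. \<Psi> (e i)) n\<bar> \<le> 2 * real n * \<kappa>"
    "\<And>i. i < n \<Longrightarrow> \<bar>\<Psi> (e' i) - real_median (\<Psi> u) (\<Psi> (e i))
       (meets_upto real_median (\<Psi> z) (\<Psi> u) (\<lambda>i. \<Psi> (e i)) n)\<bar> \<le> \<kappa> + 2 * real n * \<kappa>"
    if \<Psi>: "median_hom \<kappa> M \<mu> \<Psi>" for \<kappa> \<Psi>
  proof -
    show \<kappa>: "0 \<le> \<kappa>" using median_homD[OF \<Psi> zu(1) zu(1) zu(1)] by linarith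
    let ?o = "meets_upto real_median (\<Psi> z) (\<Psi> u) (\<lambda>i. \<Psi> (e i)) n"
    show 1: "\<bar>\<Psi> o' - ?o\<bar> \<le> 2 * real n * \<kappa>"
      unfolding o'_def by (rule median_hom_upto(2)[OF \<mu> zu e \<Psi>])
    fix i assume i: "i < n"
    have "\<bar>real_median (\<Psi> u) (\<Psi> (e i)) (\<Psi> o') - real_median (\<Psi> u) (\<Psi> (e i)) ?o\<bar> \<le> 2 * real n * \<kappa>"
      by (rule real_median_lipschitz) (use 1 \<kappa> in auto)
    then show "\<bar>\<Psi> (e' i) - real_median (\<Psi> u) (\<Psi> (e i)) ?o\<bar> \<le> \<kappa> + 2 * real n * \<kappa>"
      using median_homD[OF \<Psi> zu(2) e[OF i] o'] unfolding e'_def by linarith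
  qed
  show thesis
  proof (rule that[OF o' e' c])
    fix \<kappa> \<Psi> i j assume \<Psi>: "median_hom \<kappa> M \<mu> \<Psi>" and ij: "i < n" "j < n" "i \<noteq> j"
    let ?o = "meets_upto real_median (\<Psi> z) (\<Psi> u) (\<lambda>i. \<Psi> (e i)) n"
    let ?e = "\<lambda>i. real_median (\<Psi> u) (\<Psi> (e i)) ?o"
    note er = err(2)[OF \<Psi>] err(3)[OF \<Psi> ij(1)] err(3)[OF \<Psi> ij(2)] err(1)[OF \<Psi>]
    have "\<bar>real_median (\<Psi> u) (\<Psi> (e' i)) (\<Psi> (e' j)) - real_median (\<Psi> u) (?e i) (?e j)\<bar> \<le> \<kappa> + 2 * real n * \<kappa>"
      by (rule real_median_lipschitz) (use er in auto)
    then have cij: "\<bar>\<Psi> (c i j) - real_median (\<Psi> u) (?e i) (?e j)\<bar> \<le> \<kappa> + (\<kappa> + 2 * real n * \<kappa>)"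
      using median_homD[OF \<Psi> zu(2) e'[OF ij(1)] e'[OF ij(2)]] unfolding c_def by linarith
    have R: "R * \<kappa> = 4 * real n * \<kappa> + 4 * \<kappa>" by (simp add: R_def algebra_simps)
    show "\<bar>\<Psi> (e' i) - \<Psi> o'\<bar> \<le> R * \<kappa> \<and> \<bar>\<Psi> (c i j) - \<Psi> (e' j)\<bar> \<le> R * \<kappa> \<or>
       \<bar>\<Psi> (e' j) - \<Psi> o'\<bar> \<le> R * \<kappa> \<and> \<bar>\<Psi> (c i j) - \<Psi> (e' i)\<bar> \<le> R * \<kappa>"
      using disjoint_joins_real[OF ij, of "\<Psi> u" "\<lambda>i. \<Psi> (e i)" "\<Psi> z"] er cij unfolding R by fastforce
  next
    fix \<kappa> \<Psi> k s t
    assume \<Psi>: "median_hom \<kappa> M \<mu> \<Psi>" and k: "k < n" and s: "s \<le> t" "\<Psi> z \<le> s" "t \<le> \<Psi> u"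
      "\<And>i. i < n \<Longrightarrow> i \<noteq> k \<Longrightarrow> \<Psi> (e i) \<le> s" "t \<le> \<Psi> (e k)"
    let ?o = "meets_upto real_median (\<Psi> z) (\<Psi> u) (\<lambda>i. \<Psi> (e i)) n"
    have "?o \<le> s" by (rule meets_upto_real_le[of _ _ _ _ k]) (use s in auto)
    moreover have "t \<le> real_median (\<Psi> u) (\<Psi> (e k)) ?o" by (rule real_median_ge) (use s in auto)
    moreover have "R * \<kappa> = 4 * real n * \<kappa> + 4 * \<kappa>" by (simp add: R_def algebra_simps)
    ultimately show "\<Psi> (e' k) - \<Psi> o' \<ge> t - s - R * \<kappa>"
      using err(2)[OF \<Psi>] err(3)[OF \<Psi> k] err(1)[OF \<Psi>] by linarith
  qed
qed

section \<open>Contractions\<close>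

locale contraction_space = Metric_space M d for M :: "'a set" and d +
  fixes K :: real and \<mu> :: "'a \<Rightarrow> 'a \<Rightarrow> 'a \<Rightarrow> 'a"
  assumes geodesic: "geodesic_space M d"
    and K_pos: "K > 0"
    and median_closed: "x \<in> M \<Longrightarrow> y \<in> M \<Longrightarrow> z \<in> M \<Longrightarrow> \<mu> x y z \<in> M"
begin

abbreviation contr :: "('a \<Rightarrow> real) \<Rightarrow> bool" where
  "contr \<equiv> contraction K M d \<mu>"

abbreviation \<sigma> :: "'a \<Rightarrow> 'a \<Rightarrow> real" where
  "\<sigma> \<equiv> contraction_dist K M d \<mu>"

section \<open>Operations that preserve the constant of a contraction\<close>

lemma contrD:
  assumes "contr \<Phi>" "x \<in> M" "y \<in> M"
  shows "\<bar>\<Phi> x - \<Phi> y\<bar> \<le> d x y + K" "\<Phi> x \<le> \<Phi> y + d x y + K"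
  using assms unfolding contraction_def by (auto simp: abs_le_iff diff_le_eq algebra_simps)

lemma contr_imp_median_hom: "contr \<Phi> \<Longrightarrow> median_hom K M \<mu> \<Phi>"
  by (auto simp: contraction_def median_hom_def)

lemma contr_median_le:
  assumes "contr \<Phi>" "x \<in> M" "y \<in> M" "z \<in> M"
    and "\<Phi> x \<le> t \<and> \<Phi> y \<le> t \<or> \<Phi> x \<le> t \<and> \<Phi> z \<le> t \<or> \<Phi> y \<le> t \<and> \<Phi> z \<le> t"
  shows "\<Phi> (\<mu> x y z) \<le> t + K"
  using real_median_le[OF assms(5)] median_homD[OF contr_imp_median_hom[OF assms(1)] assms(2-4)]
  by linarith

lemma contr_uminus: "contr \<Phi> \<Longrightarrow> contr (\<lambda>x. - \<Phi> x)"
  unfolding contraction_def real_median_uminus by (simp add: abs_minus_commute abs_le_iff algebra_simps)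

lemma contr_diff_const: "contr \<Phi> \<Longrightarrow> contr (\<lambda>x. \<Phi> x - t)"
  unfolding contraction_def real_median_diff_const by simp

lemma contr_const_diff: "contr \<Phi> \<Longrightarrow> contr (\<lambda>x. t - \<Phi> x)"
  using contr_diff_const[OF contr_uminus, of \<Phi> "- t"] by simp

text \<open>On the way from \<open>{\<Phi>\<^sub>1 > 0}\<close> to \<open>{\<Phi>\<^sub>2 < 0}\<close> a geodesic meets a point with \<open>\<Phi>\<^sub>1 \<le> - K\<close> and
  \<open>\<Phi>\<^sub>2 \<ge> 0\<close>. Passing through it costs only one error \<open>K\<close>, so the constant does not deteriorate.\<close>

lemma contr_glue:
  assumes \<Phi>1: "contr \<Phi>1" and \<Phi>2: "contr \<Phi>2"
    and sep: "\<And>x. x \<in> M \<Longrightarrow> \<Phi>2 x < 0 \<Longrightarrow> \<Phi>1 x \<le> - 3 * K"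
  shows "contr (\<lambda>x. max (\<Phi>1 x) 0 + min (\<Phi>2 x) 0)" (is "contr ?\<Psi>")
proof -
  have step: "\<bar>?\<Psi> x - ?\<Psi> y\<bar> \<le> d x y + K" if xy: "x \<in> M" "y \<in> M" "\<Phi>1 x > 0" "\<Phi>2 y < 0" for x y
  proof -
    obtain f where f: "f 0 = x" "f (d x y) = y" "f ` {0..d x y} \<subseteq> M"
      "\<And>s t. s \<in> {0..d x y} \<Longrightarrow> t \<in> {0..d x y} \<Longrightarrow> d (f s) (f t) = \<bar>s - t\<bar>"
      using geodesic xy unfolding geodesic_space_def geodesic_segment_def by meson
    \<comment> \<open>The gap of 3K consists of the level - K that is crossed here, a step of length
      at most K, and the error K of \<open>\<Phi>1\<close> along this step.\<close>
    obtain t t' where t: "t \<in> {0..d x y}" "t' \<in> {0..d x y}" "\<Phi>1 (f t) > - K" "\<bar>t - t'\<bar> \<le> K"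
      "\<not> \<Phi>1 (f t') > - K \<or> t' = d x y"
      using exists_transition[of "\<lambda>t. \<Phi>1 (f t) > - K" "d x y" K] f(1) xy(3) K_pos nonneg[of x y]
      by fastforce
    have M: "f t \<in> M" "f t' \<in> M" using f(3) t by auto
    have p: "\<Phi>1 (f t') \<le> - K" using t(5) f(2) sep[OF xy(2,4)] K_pos by auto
    have "d (f t) (f t') \<le> K" using f(4) t by auto
    then have "\<Phi>1 (f t') > - 3 * K" using contrD(2)[OF \<Phi>1 M] t(3) by linarith
    then have q: "\<Phi>2 (f t') \<ge> 0" using sep[OF M(2)] by linarith
    have "\<Phi>1 x \<le> \<Phi>1 (f t') + d x (f t') + K" "\<Phi>2 (f t') \<le> \<Phi>2 y + d (f t') y + K"
      using contrD(2) \<Phi>1 \<Phi>2 M xy by blast+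
    moreover have "d x (f t') + d (f t') y = d x y"
      using f(4)[of 0 t'] f(4)[of t' "d x y"] f(1,2) t(2) by auto
    moreover have "\<Phi>2 x \<ge> 0" "\<Phi>1 y \<le> 0"
      using sep[OF xy(1)] sep[OF xy(2)] xy K_pos by linarith+
    ultimately show ?thesis using p q xy by (auto simp: max_def min_def)
  qed
  have lip: "\<bar>?\<Psi> x - ?\<Psi> y\<bar> \<le> d x y + K" if xy: "x \<in> M" "y \<in> M" for x y
  proof -
    consider "\<Phi>1 x > 0" "\<Phi>2 y < 0" | "\<Phi>1 y > 0" "\<Phi>2 x < 0"
      | "\<Phi>2 x \<ge> 0" "\<Phi>2 y \<ge> 0" | "\<Phi>1 x \<le> 0" "\<Phi>1 y \<le> 0"
      using sep[OF xy(1)] sep[OF xy(2)] K_pos by linarith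
    then show ?thesis
    proof cases
      case 1 then show ?thesis using step xy by blast
    next
      case 2 then show ?thesis using step[of y x] xy by (simp add: commute abs_minus_commute)
    next
      case 3 then show ?thesis using contrD(1)[OF \<Phi>1 xy] nonneg[of x y] K_pos by (auto simp: max_def min_def)
    next
      case 4 then show ?thesis using contrD(1)[OF \<Phi>2 xy] nonneg[of x y] K_pos by (auto simp: max_def min_def)
    qed
  qed
  have "\<bar>?\<Psi> (\<mu> x y z) - real_median (?\<Psi> x) (?\<Psi> y) (?\<Psi> z)\<bar> \<le> K"
    if xyz: "x \<in> M" "y \<in> M" "z \<in> M" for x y z
  proof -
    let ?m = "\<mu> x y z" and ?r = "real_median (?\<Psi> x) (?\<Psi> y) (?\<Psi> z)"
    have mM: "?m \<in> M" using median_closed xyz by blast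
    \<comment> \<open>At most one summand is nonzero at each point, so the summands are the positive
      and negative parts of the glued function, and truncation commutes with the median.\<close>
    have parts: "max (\<Phi>1 p) 0 = max (?\<Psi> p) 0" "min (\<Phi>2 p) 0 = min (?\<Psi> p) 0" if "p \<in> M" for p
      using sep[OF that] K_pos
      by (cases "\<Phi>2 p" "0::real" rule: linorder_cases; auto simp: max_def min_def)+
    have r1: "max (real_median (\<Phi>1 x) (\<Phi>1 y) (\<Phi>1 z)) 0 = max ?r 0"
      by (simp only: real_median_max[symmetric] parts(1)[OF xyz(1), symmetric]
          parts(1)[OF xyz(2), symmetric] parts(1)[OF xyz(3), symmetric])
    have r2: "min (real_median (\<Phi>2 x) (\<Phi>2 y) (\<Phi>2 z)) 0 = min ?r 0"
      by (simp only: real_median_min[symmetric] parts(2)[OF xyz(1), symmetric]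
          parts(2)[OF xyz(2), symmetric] parts(2)[OF xyz(3), symmetric])
    have e1: "\<bar>max (\<Phi>1 ?m) 0 - max ?r 0\<bar> \<le> K"
      using median_homD[OF contr_imp_median_hom[OF \<Phi>1] xyz] unfolding r1[symmetric]
      by (simp add: max_def abs_le_iff)
    have e2: "\<bar>min (\<Phi>2 ?m) 0 - min ?r 0\<bar> \<le> K"
      using median_homD[OF contr_imp_median_hom[OF \<Phi>2] xyz] unfolding r2[symmetric]
      by (simp add: min_def abs_le_iff)
    consider "?r > 0" | "?r = 0" | "?r < 0" by linarith
    then show ?thesis
    proof cases
      case 1
      then have "real_median (\<Phi>1 x) (\<Phi>1 y) (\<Phi>1 z) > 0" using r1 by linarith
      then have "\<Phi>1 ?m > - 3 * K"
        using median_homD[OF contr_imp_median_hom[OF \<Phi>1] xyz] K_pos by linarith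
      then have "min (\<Phi>2 ?m) 0 = 0" using sep[OF mM] by linarith
      then show ?thesis using 1 e1 by simp
    next
      case 3
      then have "real_median (\<Phi>2 x) (\<Phi>2 y) (\<Phi>2 z) < 0" using r2 by linarith
      then have "\<Phi>2 x < 0 \<and> \<Phi>2 y < 0 \<or> \<Phi>2 x < 0 \<and> \<Phi>2 z < 0 \<or> \<Phi>2 y < 0 \<and> \<Phi>2 z < 0"
        using real_median_ge[of 0 "\<Phi>2 x" "\<Phi>2 y" "\<Phi>2 z"] by linarith
      then have "\<Phi>1 ?m \<le> - 3 * K + K"
        using sep xyz by (intro contr_median_le[OF \<Phi>1 xyz]) blast
      then have "max (\<Phi>1 ?m) 0 = 0" using K_pos by linarith
      then show ?thesis using 3 e2 by simp
    next
      case 2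
      \<comment> \<open>One part lies in [0, K] and the other in [- K, 0], so the two errors do not
        add up.\<close>
      have "\<bar>max (\<Phi>1 ?m) 0\<bar> \<le> K" "\<bar>min (\<Phi>2 ?m) 0\<bar> \<le> K" using e1 e2 unfolding 2 by simp_all
      then show ?thesis unfolding 2 by linarith
    qed
  qed
  then show ?thesis unfolding contraction_def by (intro conjI ballI lip)
qed

subsection \<open>The metric\<close>

lemma contr_zero: "contr (\<lambda>x. 0)"
  using K_pos by (simp add: contraction_def real_median_def add_nonneg_nonneg)

lemma contr_le_\<sigma>:
  assumes "contr \<Phi>" "a \<in> M" "b \<in> M"
  shows "\<Phi> a - \<Phi> b \<le> \<sigma> a b" "\<Phi> b - \<Phi> a \<le> \<sigma> a b"
proof -
  let ?S = "{r. r \<ge> 0 \<and> (\<exists>\<Phi>. contr \<Phi> \<and> \<Phi> a = 0 \<and> \<Phi> b = r)}"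
  have bdd: "bdd_above ?S"
  proof (rule bdd_aboveI[of _ "d a b + K"])
    fix r assume "r \<in> ?S"
    then obtain \<Psi> where "contr \<Psi>" "\<Psi> a = 0" "\<Psi> b = r" by blast
    then show "r \<le> d a b + K" using contrD(1)[of \<Psi> a b] assms by auto
  qed
  have \<sigma>: "\<sigma> a b = Sup ?S" using assms by (simp add: contraction_dist_def)
  have up: "\<Psi> b - \<Psi> a \<le> \<sigma> a b" if "contr \<Psi>" for \<Psi>
  proof (cases "\<Psi> b - \<Psi> a \<ge> 0")
    case True
    then have "\<Psi> b - \<Psi> a \<in> ?S"
      using contr_diff_const[OF that, of "\<Psi> a"] by (auto intro!: exI[of _ "\<lambda>x. \<Psi> x - \<Psi> a"])
    then show ?thesis unfolding \<sigma> by (rule cSup_upper[OF _ bdd])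
  next
    case False
    have "0 \<in> ?S" using contr_zero by auto
    then have "0 \<le> \<sigma> a b" unfolding \<sigma> by (rule cSup_upper[OF _ bdd])
    then show ?thesis using False by linarith
  qed
  show "\<Phi> a - \<Phi> b \<le> \<sigma> a b" "\<Phi> b - \<Phi> a \<le> \<sigma> a b"
    using up[OF assms(1)] up[OF contr_uminus[OF assms(1)]] by auto
qed

lemma \<sigma>_le:
  assumes "a \<in> M" "b \<in> M" "\<And>\<Phi>. contr \<Phi> \<Longrightarrow> \<Phi> b - \<Phi> a \<le> B"
  shows "\<sigma> a b \<le> B"
proof -
  let ?S = "{r. r \<ge> 0 \<and> (\<exists>\<Phi>. contr \<Phi> \<and> \<Phi> a = 0 \<and> \<Phi> b = r)}"
  have "Sup ?S \<le> B"
  proof (rule cSup_least)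
    show "?S \<noteq> {}" using contr_zero by auto
    fix r assume "r \<in> ?S"
    then obtain \<Phi> where "contr \<Phi>" "\<Phi> a = 0" "\<Phi> b = r" by blast
    then show "r \<le> B" using assms(3)[of \<Phi>] by simp
  qed
  then show ?thesis using assms by (simp add: contraction_dist_def)
qed

lemma \<sigma>_nonneg: "0 \<le> \<sigma> a b"
  using contr_le_\<sigma>(1)[OF contr_zero, of a b] by (cases "a \<in> M \<and> b \<in> M") (auto simp: contraction_dist_def)

lemma \<sigma>_commute: "\<sigma> a b = \<sigma> b a"
proof (cases "a \<in> M \<and> b \<in> M")
  case True
  then show ?thesis by (intro antisym \<sigma>_le contr_le_\<sigma>) auto
qed (auto simp: contraction_dist_def)

lemma \<sigma>_metric: "Metric_space M \<sigma>"
proof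
  show "0 \<le> \<sigma> a b" "\<sigma> a b = \<sigma> b a" for a b by (rule \<sigma>_nonneg, rule \<sigma>_commute)
  show "\<sigma> a c \<le> \<sigma> a b + \<sigma> b c" if "a \<in> M" "b \<in> M" "c \<in> M" for a b c
  proof (rule \<sigma>_le)
    fix \<Phi> assume "contr \<Phi>"
    then have "\<Phi> b - \<Phi> a \<le> \<sigma> a b" "\<Phi> c - \<Phi> b \<le> \<sigma> b c" using contr_le_\<sigma> that by blast+
    then show "\<Phi> c - \<Phi> a \<le> \<sigma> a b + \<sigma> b c" by linarith
  qed (use that in auto)
  fix a b assume ab: "a \<in> M" "b \<in> M"
  show "\<sigma> a b = 0 \<longleftrightarrow> a = b"
  proof
    assume 0: "\<sigma> a b = 0"
    \<comment> \<open>a bump of height \<open>K\<close> at a single point is a \<open>K\<close>-contraction\<close>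
    let ?\<Phi> = "\<lambda>x. if x = b then K else 0"
    have b: "0 \<le> ?\<Phi> x" "?\<Phi> x \<le> K" for x using K_pos by auto
    have "contr ?\<Phi>"
      unfolding contraction_def
    proof (intro conjI ballI)
      show "\<bar>?\<Phi> x - ?\<Phi> y\<bar> \<le> d x y + K" for x y using b[of x] b[of y] nonneg[of x y] by linarith
      show "\<bar>?\<Phi> (\<mu> x y z) - real_median (?\<Phi> x) (?\<Phi> y) (?\<Phi> z)\<bar> \<le> K" for x y z
        using b[of "\<mu> x y z"] real_median_le[of "?\<Phi> x" K "?\<Phi> y" "?\<Phi> z"]
          real_median_ge[of 0 "?\<Phi> x" "?\<Phi> y" "?\<Phi> z"] b[of x] b[of y] by linarith
    qed
    then show "a = b" using contr_le_\<sigma>(2)[of ?\<Phi> a b] ab 0 K_pos by (auto split: if_splits)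
  next
    assume "a = b"
    then show "\<sigma> a b = 0" using \<sigma>_nonneg[of a b] \<sigma>_le[of a b 0] ab by auto
  qed
qed

lemma \<sigma>_isometry:
  assumes g: "isometry_between M d M d g"
    and eq: "\<And>x y z. x \<in> M \<Longrightarrow> y \<in> M \<Longrightarrow> z \<in> M \<Longrightarrow> \<mu> (g x) (g y) (g z) = g (\<mu> x y z)"
    and ab: "a \<in> M" "b \<in> M"
  shows "\<sigma> (g a) (g b) = \<sigma> a b"
proof (rule antisym)
  have bij: "bij_betw g M M" and iso: "\<And>x y. x \<in> M \<Longrightarrow> y \<in> M \<Longrightarrow> d (g x) (g y) = d x y"
    using g by (auto simp: isometry_between_def)
  have gM: "g x \<in> M" if "x \<in> M" for x using bij that by (auto simp: bij_betw_def)
  show "\<sigma> (g a) (g b) \<le> \<sigma> a b"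
  proof (rule \<sigma>_le)
    fix \<Phi> assume \<Phi>: "contr \<Phi>"
    have "contr (\<lambda>x. \<Phi> (g x))"
      unfolding contraction_def
    proof (intro conjI ballI)
      fix x y assume "x \<in> M" "y \<in> M"
      then show "\<bar>\<Phi> (g x) - \<Phi> (g y)\<bar> \<le> d x y + K" using contrD(1)[OF \<Phi> gM gM] iso by metis
    next
      fix x y z assume *: "x \<in> M" "y \<in> M" "z \<in> M"
      then show "\<bar>\<Phi> (g (\<mu> x y z)) - real_median (\<Phi> (g x)) (\<Phi> (g y)) (\<Phi> (g z))\<bar> \<le> K"
        using median_homD[OF contr_imp_median_hom[OF \<Phi>] gM[OF *(1)] gM[OF *(2)] gM[OF *(3)]] eq by simp
    qed
    then show "\<Phi> (g b) - \<Phi> (g a) \<le> \<sigma> a b" using contr_le_\<sigma>(2) ab by blast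
  qed (use gM ab in auto)
  show "\<sigma> a b \<le> \<sigma> (g a) (g b)"
  proof (rule \<sigma>_le[OF ab])
    fix \<Phi> assume \<Phi>: "contr \<Phi>"
    define h where "h = inv_into M g"
    have hM: "h x \<in> M" and gh: "g (h x) = x" if "x \<in> M" for x
      using that bij unfolding h_def bij_betw_def by (auto intro: inv_into_into f_inv_into_f)
    have hg: "h (g x) = x" if "x \<in> M" for x
      using that bij unfolding h_def bij_betw_def by auto
    have "contr (\<lambda>x. \<Phi> (h x))"
      unfolding contraction_def
    proof (intro conjI ballI)
      fix x y assume "x \<in> M" "y \<in> M"
      then show "\<bar>\<Phi> (h x) - \<Phi> (h y)\<bar> \<le> d x y + K"
        using contrD(1)[OF \<Phi> hM hM] iso[OF hM hM] gh by metis
    next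
      fix x y z assume *: "x \<in> M" "y \<in> M" "z \<in> M"
      have "h (\<mu> x y z) = \<mu> (h x) (h y) (h z)"
        using eq[OF hM hM hM, OF *] gh * hg[OF median_closed[OF hM hM hM]] by metis
      then show "\<bar>\<Phi> (h (\<mu> x y z)) - real_median (\<Phi> (h x)) (\<Phi> (h y)) (\<Phi> (h z))\<bar> \<le> K"
        using median_homD[OF contr_imp_median_hom[OF \<Phi>] hM[OF *(1)] hM[OF *(2)] hM[OF *(3)]] by simp
    qed
    from contr_le_\<sigma>(2)[OF this gM[OF ab(1)] gM[OF ab(2)]]
    show "\<Phi> b - \<Phi> a \<le> \<sigma> (g a) (g b)" using hg ab by simp
  qed
qed

subsection \<open>Coarse Helly property\<close>

text \<open>Take three points, each obtained by omitting a different index. Every \<Phi> is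
  controlled at two of them at least, hence at their median, up to one more K.\<close>

lemma finite_helly:
  assumes "finite I" "M \<noteq> {}"
    and "\<And>i. i \<in> I \<Longrightarrow> contr (\<Phi> i)"
    and "\<And>i j. i \<in> I \<Longrightarrow> j \<in> I \<Longrightarrow> \<exists>x\<in>M. \<Phi> i x \<le> c i \<and> \<Phi> j x \<le> c j"
  shows "\<exists>x\<in>M. \<forall>i\<in>I. \<Phi> i x \<le> c i + real (card I) * K"
  using assms
proof (induction "card I" arbitrary: I rule: less_induct)
  case less
  consider "card I = 0" | "card I = 1" | "card I = 2" | "card I \<ge> 3" by linarith
  then show ?case
  proof cases
    case 1
    then show ?thesis using less.prems by auto
  next
    case 2
    then obtain i where "I = {i}" by (auto simp: card_1_singleton_iff)
    then obtain x where "x \<in> M" "\<Phi> i x \<le> c i" using less.prems(4)[of i i] by auto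
    then show ?thesis using \<open>I = {i}\<close> K_pos by (intro bexI[of _ x]) auto
  next
    case 3
    then obtain i j where I: "I = {i, j}" by (auto simp: card_2_iff)
    then obtain x where "x \<in> M" "\<Phi> i x \<le> c i" "\<Phi> j x \<le> c j" using less.prems(4)[of i j] by auto
    then show ?thesis using I K_pos by (intro bexI[of _ x]) (auto intro: add_increasing2)
  next
    case 4
    then obtain T where T: "T \<subseteq> I" "card T = 3" using obtain_subset_with_card_n by metis
    then obtain i1 i2 i3 where i: "T = {i1, i2, i3}" "i1 \<noteq> i2" "i2 \<noteq> i3" "i1 \<noteq> i3"
      by (auto simp: card_3_iff)
    have *: "\<exists>x\<in>M. \<forall>j\<in>I - {i}. \<Phi> j x \<le> c j + real (card I - 1) * K" if "i \<in> I" for i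
    proof -
      have c: "card (I - {i}) = card I - 1" using that by (rule card_Diff_singleton)
      have "\<exists>x\<in>M. \<forall>j\<in>I - {i}. \<Phi> j x \<le> c j + real (card (I - {i})) * K"
        by (rule less.hyps) (use c 4 less.prems in auto)
      then show ?thesis unfolding c .
    qed
    obtain x1 x2 x3 where x: "x1 \<in> M" "x2 \<in> M" "x3 \<in> M"
      "\<forall>j\<in>I - {i1}. \<Phi> j x1 \<le> c j + real (card I - 1) * K"
      "\<forall>j\<in>I - {i2}. \<Phi> j x2 \<le> c j + real (card I - 1) * K"
      "\<forall>j\<in>I - {i3}. \<Phi> j x3 \<le> c j + real (card I - 1) * K"
      using *[of i1] *[of i2] *[of i3] T i by auto
    have "\<Phi> j (\<mu> x1 x2 x3) \<le> c j + real (card I) * K" if j: "j \<in> I" for j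
    proof -
      have "\<Phi> j (\<mu> x1 x2 x3) \<le> c j + real (card I - 1) * K + K"
        by (rule contr_median_le[OF less.prems(3)[OF j] x(1-3)]) (use x(4-6) j i in blast)
      moreover have "real (card I - 1) = real (card I) - 1" using 4 by auto
      ultimately show ?thesis by (simp add: algebra_simps)
    qed
    then show ?thesis using median_closed[OF x(1-3)] by blast
  qed
qed

subsection \<open>Coarse injectivity\<close>

text \<open>Of an n-cube of width \<Lambda> only the bottom z, the top u and the n neighbours
  \<open>e i\<close> of the bottom are recorded; further vertices are built from these by medians
  when required.\<close>

definition rank_lt :: "nat \<Rightarrow> real \<Rightarrow> bool" where
  "rank_lt n \<Lambda> \<longleftrightarrow> \<not> (\<exists>\<Phi> s z u e. z \<in> M \<and> u \<in> M \<and>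
     (\<forall>i<n. contr (\<Phi> i) \<and> e i \<in> M \<and> \<Phi> i z \<le> s i \<and> s i + \<Lambda> \<le> \<Phi> i u \<and> s i + \<Lambda> \<le> \<Phi> i (e i) \<and>
        (\<forall>j<n. j \<noteq> i \<longrightarrow> \<Phi> i (e j) \<le> s i)))"

text \<open>The pointwise minimal functions of this kind are the points of the injective hull of (M,
  \<sigma>).\<close>

definition radius_function :: "('a \<Rightarrow> real) \<Rightarrow> bool" where
  "radius_function f \<longleftrightarrow> (\<forall>x\<in>M. \<forall>y\<in>M. \<sigma> x y \<le> f x + f y)"

text \<open>The pair \<open>(\<Phi>, c)\<close> stands for the halfspace \<open>{\<Phi> \<le> c}\<close>, which contains a ball of radius \<open>f x\<close>.\<close>

definition halfspaces :: "('a \<Rightarrow> real) \<Rightarrow> (('a \<Rightarrow> real) \<times> real) set" where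
  "halfspaces f = {(\<Phi>, c). contr \<Phi> \<and> (\<exists>x\<in>M. \<Phi> x + f x \<le> c)}"

lemma radius_functionD: "radius_function f \<Longrightarrow> x \<in> M \<Longrightarrow> y \<in> M \<Longrightarrow> \<sigma> x y \<le> f x + f y"
  by (simp add: radius_function_def)

lemma radius_function_nonneg: "radius_function f \<Longrightarrow> x \<in> M \<Longrightarrow> 0 \<le> f x"
  using radius_functionD[of f x x] \<sigma>_nonneg[of x x] by linarith

text \<open>Otherwise gluing the two functions separates two balls that are too close.\<close>

lemma halfspaces_meet:
  assumes f: "radius_function f" and 1: "(\<Phi>1, c1) \<in> halfspaces f" and 2: "(\<Phi>2, c2) \<in> halfspaces f"
  shows "\<exists>x\<in>M. \<Phi>1 x \<le> c1 + (3 * K + 1) \<and> \<Phi>2 x \<le> c2 + (3 * K + 1)"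
proof (rule ccontr)
  assume n: "\<not> ?thesis"
  obtain x1 x2 where x: "x1 \<in> M" "x2 \<in> M" "contr \<Phi>1" "contr \<Phi>2" "\<Phi>1 x1 + f x1 \<le> c1" "\<Phi>2 x2 + f x2 \<le> c2"
    using 1 2 unfolding halfspaces_def by auto
  \<comment> \<open>Thresholds raised by 1 make the values at \<open>x1\<close> and
    \<open>x2\<close> differ by at least \<open>f x1 + f x2 + 2\<close>, strictly more than \<sigma>
    allows.\<close>
  let ?\<Psi> = "\<lambda>x. max (c1 + 1 - \<Phi>1 x) 0 + min (\<Phi>2 x - (c2 + 1)) 0"
  have \<Psi>: "contr ?\<Psi>"
  proof (rule contr_glue[OF contr_const_diff contr_diff_const])
    fix x assume "x \<in> M" "\<Phi>2 x - (c2 + 1) < 0"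
    then show "c1 + 1 - \<Phi>1 x \<le> - 3 * K" using n K_pos by force
  qed (use x in auto)
  have f0: "0 \<le> f x1" "0 \<le> f x2" using radius_function_nonneg[OF f] x by auto
  have "\<Phi>2 x1 > c2 + (3 * K + 1)" "\<Phi>1 x2 > c1 + (3 * K + 1)" using n x K_pos f0 by force+
  then have "?\<Psi> x1 \<ge> f x1 + 1" "?\<Psi> x2 \<le> - f x2 - 1" using x f0 K_pos by (auto simp: max_def min_def)
  then show False
    using contr_le_\<sigma>(1)[OF \<Psi> x(1,2)] radius_functionD[OF f x(1,2)] by linarith
qed

lemma halfspaces_depth_le:
  assumes "radius_function f" "(\<Phi>, c) \<in> halfspaces f" "a \<in> M"
  shows "\<Phi> a - c \<le> f a"
proof -
  obtain x where x: "contr \<Phi>" "x \<in> M" "\<Phi> x + f x \<le> c" using assms(2) unfolding halfspaces_def by auto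
  show ?thesis
    using contr_le_\<sigma>(1)[OF x(1) assms(3) x(2)] radius_functionD[OF assms(1,3) x(2)] x(3) by linarith
qed

text \<open>The halfspaces that lie deep as seen from \<open>a\<close> all coarsely contain one of boundedly many of
  them. Choose greedily a halfspace of almost maximal depth that contains none of the previous
  ones. A later one is not nested in an earlier one, as gluing would produce a deeper choice,
  so any two cross, and the rank bounds their number.\<close>

lemma deep_halfspaces_cover:
  assumes rank: "rank_lt n \<Lambda>" and \<Lambda>: "0 \<le> \<Lambda>" and f: "radius_function f" and a: "a \<in> M"
    and C: "3 * K + 1 \<le> C"
  defines "\<Lambda>' \<equiv> \<Lambda> + 2 * real n * K"
  defines "T \<equiv> C + real n * (\<Lambda>' + 3 * K + 2) + \<Lambda>'"
  shows "\<exists>S\<subseteq>halfspaces f. finite S \<and> card S < n \<and>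
    (\<forall>q\<in>halfspaces f. snd q + T \<le> fst q a \<longrightarrow>
       (\<exists>q'\<in>S. \<forall>x\<in>M. fst q' x \<le> snd q' + C \<longrightarrow> fst q x \<le> snd q + T))"
proof (rule ccontr)
  assume none: "\<not> ?thesis"
  define cand where "cand = (\<lambda>S. {q\<in>halfspaces f. snd q + T \<le> fst q a \<and>
    (\<forall>q'\<in>S. \<exists>x\<in>M. fst q' x \<le> snd q' + C \<and> snd q + T < fst q x)})"
  define D where "D = (\<lambda>q :: ('a \<Rightarrow> real) \<times> real. fst q a - snd q)"
  define good where "good = (\<lambda>S q. q \<in> cand S \<and> (\<forall>q'\<in>cand S. D q' \<le> D q + 1))"
  have ex: "\<exists>q. good S q" if S: "S \<subseteq> halfspaces f" "finite S" "card S < n" for S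
  proof -
    have "\<exists>q\<in>halfspaces f. snd q + T \<le> fst q a \<and>
        (\<forall>q'\<in>S. \<exists>x\<in>M. fst q' x \<le> snd q' + C \<and> snd q + T < fst q x)"
      using none S by (meson not_le)
    then have ne: "D ` cand S \<noteq> {}" unfolding cand_def by blast
    have bdd: "bdd_above (D ` cand S)"
      by (rule bdd_aboveI[of _ "f a"]) (use halfspaces_depth_le[OF f _ a] in \<open>auto simp: cand_def D_def\<close>)
    obtain q where q: "q \<in> cand S" "Sup (D ` cand S) - 1 < D q"
      using less_cSup_iff[OF ne bdd, of "Sup (D ` cand S) - 1"] by auto
    have "D q' \<le> D q + 1" if "q' \<in> cand S" for q'
      using cSup_upper[OF imageI[OF that] bdd] q(2) by linarith
    then show ?thesis using q unfolding good_def by blast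
  qed
  have "\<exists>p. \<forall>k. k < n \<longrightarrow> good (p ` {..<k}) (p k)"
  proof (rule dependent_wellorder_choice)
    fix r and g h :: "nat \<Rightarrow> ('a \<Rightarrow> real) \<times> real" and x :: nat
    assume "\<And>y. y < x \<Longrightarrow> g y = h y"
    then have "g ` {..<x} = h ` {..<x}" by (intro image_cong) auto
    then show "(x < n \<longrightarrow> good (g ` {..<x}) r) = (x < n \<longrightarrow> good (h ` {..<x}) r)" by simp
  next
    fix x and g :: "nat \<Rightarrow> ('a \<Rightarrow> real) \<times> real"
    assume IH: "\<And>y. y < x \<Longrightarrow> y < n \<longrightarrow> good (g ` {..<y}) (g y)"
    show "\<exists>r. x < n \<longrightarrow> good (g ` {..<x}) r"
    proof (cases "x < n")
      case True
      then have "g ` {..<x} \<subseteq> halfspaces f" using IH unfolding good_def cand_def by auto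
      moreover have "card (g ` {..<x}) < n" using card_image_le[of "{..<x}" g] True by auto
      ultimately show ?thesis using ex[of "g ` {..<x}"] by auto
    qed auto
  qed
  then obtain p where p: "\<And>k. k < n \<Longrightarrow> good (p ` {..<k}) (p k)" by blast
  define \<Phi> where "\<Phi> = (\<lambda>i. fst (p i))"
  define c where "c = (\<lambda>i. snd (p i))"
  have hs: "(\<Phi> i, c i) \<in> halfspaces f" and deep: "c i + T \<le> \<Phi> i a" if "i < n" for i
    using p[OF that] unfolding good_def cand_def \<Phi>_def c_def by auto
  have ctr: "contr (\<Phi> i)" if "i < n" for i using hs[OF that] unfolding halfspaces_def by auto
  have later: "\<exists>x\<in>M. \<Phi> i x \<le> c i + C \<and> c j + T < \<Phi> j x" if "i < j" "j < n" for i j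
    using p[OF that(2)] that(1) unfolding good_def cand_def \<Phi>_def c_def by auto
  have greedy: "fst q a - snd q \<le> \<Phi> i a - c i + 1"
    if "i < n" "q \<in> halfspaces f" "snd q + T \<le> fst q a"
      "\<And>k. k < i \<Longrightarrow> \<exists>x\<in>M. \<Phi> k x \<le> c k + C \<and> snd q + T < fst q x" for i q
  proof -
    have "q \<in> cand (p ` {..<i})" using that unfolding cand_def \<Phi>_def c_def by auto
    then show ?thesis using p[OF that(1)] unfolding good_def D_def \<Phi>_def c_def by auto
  qed
  \<comment> \<open>The margin grows along the sequence. One increment consists of \<Lambda>' for
    the width of the cube, 3K for gluing, and 2 to beat the slack 1 in the almost maximal
    depth.\<close>
  define S where "S = (\<lambda>i. C + real i * (\<Lambda>' + 3 * K + 2))"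
  have \<Lambda>'0: "0 \<le> \<Lambda>'" using \<Lambda> K_pos unfolding \<Lambda>'_def by simp
  have S_mono: "S i \<le> S j" if "i \<le> j" for i j
    unfolding S_def using that \<Lambda>'0 K_pos by (intro add_left_mono mult_right_mono) auto
  have S_Suc: "S (Suc i) = S i + \<Lambda>' + 3 * K + 2" for i unfolding S_def by (simp add: algebra_simps)
  have S0: "C \<le> S i" for i using S_mono[of 0 i] by (simp add: S_def)
  have T: "T = S n + \<Lambda>'" by (simp add: T_def S_def)
  have S_T: "S i + \<Lambda>' + 3 * K + 2 + \<Lambda>' \<le> T" if "i < n" for i
    using S_mono[of "Suc i" n] that unfolding T S_Suc by linarith
  have earlier: "\<exists>x\<in>M. \<Phi> j x \<le> c j + S (Suc i) \<and> c i + S i + \<Lambda>' < \<Phi> i x" if ij: "i < j" "j < n" for i j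
  proof (rule ccontr)
    assume n: "\<not> ?thesis"
    have i: "i < n" using ij by linarith
    define B where "B = S i + \<Lambda>'"
    have nest: "\<Phi> i x \<le> c i + B" if "x \<in> M" "\<Phi> j x \<le> c j + S (Suc i)" for x
      using n that unfolding B_def by force
    have SB: "S (Suc i) = B + 3 * K + 2" unfolding S_Suc B_def by simp
    have B0: "0 \<le> B" using S0[of i] C K_pos \<Lambda>'0 unfolding B_def by linarith
    have BT: "B + 3 * K + 2 \<le> T" using S_T[OF i] \<Lambda>'0 unfolding B_def by linarith
    \<comment> \<open>Following \<Phi> i outside and \<Phi> j inside gives a halfspace that was a
      candidate at stage i and is deeper by 2 than the one chosen.\<close>
    let ?\<Psi> = "\<lambda>x. max (\<Phi> i x - (c i + B + 3 * K)) 0 + min (\<Phi> j x - (c j + S (Suc i))) 0"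
    have \<Psi>: "contr ?\<Psi>"
    proof (rule contr_glue[OF contr_diff_const[OF ctr[OF i]] contr_diff_const[OF ctr[OF ij(2)]]])
      fix x assume "x \<in> M" "\<Phi> j x - (c j + S (Suc i)) < 0"
      then show "\<Phi> i x - (c i + B + 3 * K) \<le> - 3 * K" using nest[of x] by linarith
    qed
    have out: "?\<Psi> x = \<Phi> i x - (c i + B + 3 * K)" if "x \<in> M" "\<Phi> i x \<ge> c i + B + 3 * K" for x
      using nest[OF that(1)] that(2) K_pos by (auto simp: max_def min_def)
    obtain y where y: "y \<in> M" "\<Phi> j y + f y \<le> c j" using hs[OF ij(2)] unfolding halfspaces_def by auto
    have fy: "0 \<le> f y" using radius_function_nonneg[OF f y(1)] .
    have "\<Phi> j y \<le> c j + S (Suc i)" using y(2) fy B0 SB K_pos by linarith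
    moreover from nest[OF y(1) this] have "\<Phi> i y \<le> c i + B + 3 * K" using K_pos by linarith
    ultimately have "?\<Psi> y + f y \<le> - S (Suc i)" using y(2) by (simp add: max_def min_def)
    then have H: "(?\<Psi>, - S (Suc i)) \<in> halfspaces f" using \<Psi> y(1) unfolding halfspaces_def by blast
    have \<Psi>a: "?\<Psi> a = \<Phi> i a - (c i + B + 3 * K)"
      by (rule out[OF a]) (use deep[OF i] BT in linarith)
    have "?\<Psi> a - - S (Suc i) \<le> \<Phi> i a - c i + 1"
    proof (rule greedy[OF i H, simplified fst_conv snd_conv])
      show "- S (Suc i) + T \<le> ?\<Psi> a" unfolding \<Psi>a using deep[OF i] SB by linarith
      fix k assume "k < i"
      then obtain x where x: "x \<in> M" "\<Phi> k x \<le> c k + C" "c i + T < \<Phi> i x" using later[of k i] i by blast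
      have "?\<Psi> x = \<Phi> i x - (c i + B + 3 * K)" by (rule out[OF x(1)]) (use x(3) BT in linarith)
      then have "- S (Suc i) + T < ?\<Psi> x" using x(3) SB by linarith
      then show "\<exists>x\<in>M. \<Phi> k x \<le> c k + C \<and> - S (Suc i) + T < ?\<Psi> x" using x by blast
    qed
    then show False unfolding \<Psi>a using SB by linarith
  qed
  have meet: "\<exists>x\<in>M. \<Phi> i x \<le> c i + S i \<and> \<Phi> j x \<le> c j + S j" if ij: "i < n" "j < n" for i j
  proof -
    obtain x where "x \<in> M" "\<Phi> i x \<le> c i + (3 * K + 1)" "\<Phi> j x \<le> c j + (3 * K + 1)"
      using halfspaces_meet[OF f hs[OF ij(1)] hs[OF ij(2)]] by blast
    then show ?thesis using S0[of i] S0[of j] C by (intro bexI[of _ x] conjI) linarith+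
  qed
  \<comment> \<open>For i < j this comes from almost maximality, for i > j from the condition on
    candidates. With \<open>meet\<close>, and with a lying outside all the halfspaces, every
    quadrant of each pair is inhabited.\<close>
  have cross: "\<exists>x\<in>M. - \<Phi> i x \<le> - (c i + S i + \<Lambda>') \<and> \<Phi> j x \<le> c j + S j" if ij: "i < n" "j < n" "i \<noteq> j" for i j
  proof (cases "i < j")
    case True
    then obtain x where "x \<in> M" "\<Phi> j x \<le> c j + S (Suc i)" "c i + S i + \<Lambda>' < \<Phi> i x"
      using earlier ij by blast
    then show ?thesis using S_mono[of "Suc i" j] True by (intro bexI[of _ x]) auto
  next
    case False
    then obtain x where "x \<in> M" "\<Phi> j x \<le> c j + C" "c i + T < \<Phi> i x"
      using later[of j i] ij by auto
    then show ?thesis using S0[of j] S_T[OF ij(1)] \<Lambda>'0 K_pos by (intro bexI[of _ x] conjI) linarith+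
  qed
  have M: "M \<noteq> {}" using a by blast
  have "\<exists>z\<in>M. \<forall>i\<in>{..<n}. \<Phi> i z \<le> c i + S i + real (card {..<n}) * K"
    by (rule finite_helly) (use M ctr meet in auto)
  then obtain z where z: "z \<in> M" "\<And>i. i < n \<Longrightarrow> \<Phi> i z \<le> c i + S i + real n * K" by auto
  have "\<exists>x\<in>M. - \<Phi> i x \<le> - (c i + S i + \<Lambda>') + real n * K \<and>
     (\<forall>j<n. j \<noteq> i \<longrightarrow> \<Phi> j x \<le> c j + S j + real n * K)" if i: "i < n" for i
  proof -
    \<comment> \<open>Helly with the i-th halfspace replaced by its complement yields the vertex
      \<open>e i\<close>. The loss of n * K occurs on both sides of the gap, whence 2 * n * K in
      \<Lambda>'.\<close>
    let ?\<Phi> = "\<lambda>j. if j = i then (\<lambda>x. - \<Phi> i x) else \<Phi> j"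
    let ?c = "\<lambda>j. if j = i then - (c i + S i + \<Lambda>') else c j + S j"
    have "- \<Phi> i a \<le> - (c i + S i + \<Lambda>')" using deep[OF i] S_T[OF i] \<Lambda>'0 K_pos by linarith
    then have "\<exists>x\<in>M. ?\<Phi> j x \<le> ?c j \<and> ?\<Phi> k x \<le> ?c k" if "j < n" "k < n" for j k
      using a cross[OF i, of j] cross[OF i, of k] meet[of j k] that
      by (cases "j = i"; cases "k = i") auto
    moreover have "contr (?\<Phi> j)" if "j < n" for j using ctr contr_uminus that by auto
    ultimately have "\<exists>x\<in>M. \<forall>j\<in>{..<n}. ?\<Phi> j x \<le> ?c j + real (card {..<n}) * K"
      by (intro finite_helly) (use M in auto)
    then obtain x where "x \<in> M" and x: "\<And>j. j < n \<Longrightarrow> ?\<Phi> j x \<le> ?c j + real n * K" by auto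
    moreover have "\<Phi> j x \<le> c j + S j + real n * K" if "j < n" "j \<noteq> i" for j
      using x[OF that(1)] that(2) by simp
    ultimately show ?thesis using x[OF i] by auto
  qed
  then obtain e where e: "\<And>i. i < n \<Longrightarrow> e i \<in> M"
    "\<And>i. i < n \<Longrightarrow> - \<Phi> i (e i) \<le> - (c i + S i + \<Lambda>') + real n * K"
    "\<And>i j. i < n \<Longrightarrow> j < n \<Longrightarrow> j \<noteq> i \<Longrightarrow> \<Phi> j (e i) \<le> c j + S j + real n * K"
    by metis
  have "c i + S i + real n * K + \<Lambda> \<le> \<Phi> i a" if "i < n" for i
    using deep[OF that] S_T[OF that] \<Lambda>'0 K_pos mult_nonneg_nonneg[of "real n" K] unfolding \<Lambda>'_def by linarith
  moreover have "c i + S i + real n * K + \<Lambda> \<le> \<Phi> i (e i)" if "i < n" for i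
    using e(2)[OF that] unfolding \<Lambda>'_def by linarith
  ultimately have "\<forall>i<n. contr (\<Phi> i) \<and> e i \<in> M \<and> \<Phi> i z \<le> c i + S i + real n * K \<and>
      c i + S i + real n * K + \<Lambda> \<le> \<Phi> i a \<and> c i + S i + real n * K + \<Lambda> \<le> \<Phi> i (e i) \<and>
      (\<forall>j<n. j \<noteq> i \<longrightarrow> \<Phi> i (e j) \<le> c i + S i + real n * K)"
    using ctr e(1,3) z(2) by auto
  then have "\<not> rank_lt n \<Lambda>"
    unfolding rank_lt_def not_not using z(1) a
    by (intro exI[of _ \<Phi>] exI[of _ "\<lambda>i. c i + S i + real n * K"] exI[of _ z] exI[of _ a] exI[of _ e] conjI)
  then show False using rank by contradiction
qed

text \<open>Starting from any point \<open>a\<close>, choose \<open>y0\<close> in all halfspaces that are deep as seen from \<open>a\<close>, and \<open>y\<close>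
  in all those that are deep as seen from \<open>a\<close> or \<open>y0\<close>. Then each halfspace coarsely contains two of
  the points \<open>a\<close>, \<open>y0\<close>, \<open>y\<close>, and hence their median.\<close>

theorem coarse_injectivity:
  assumes rank: "rank_lt n \<Lambda>" and \<Lambda>: "0 \<le> \<Lambda>" and M: "M \<noteq> {}"
  shows "\<exists>\<delta>\<ge>0. \<forall>f. radius_function f \<longrightarrow> (\<exists>y\<in>M. \<forall>x\<in>M. \<sigma> y x \<le> f x + \<delta>)"
proof -
  \<comment> \<open>Pairs meet up to 3K + 1, and Helly is applied to at most 2n halfspaces, the
    members of two covering families.\<close>
  define C where "C = 3 * K + 1 + real (2 * n) * K"
  define T where "T = C + real n * (\<Lambda> + 2 * real n * K + 3 * K + 2) + (\<Lambda> + 2 * real n * K)"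
  have C: "3 * K + 1 \<le> C" using K_pos unfolding C_def by simp
  have T: "C \<le> T" using K_pos \<Lambda> unfolding T_def by simp
  have "\<exists>y\<in>M. \<forall>x\<in>M. \<sigma> y x \<le> f x + (T + K)" if f: "radius_function f" for f
  proof -
    have common: "\<exists>y\<in>M. \<forall>q\<in>S. fst q y \<le> snd q + C"
      if S: "S \<subseteq> halfspaces f" "finite S" "card S \<le> 2 * n" for S
    proof -
      have "\<exists>y\<in>M. \<forall>q\<in>S. fst q y \<le> snd q + (3 * K + 1) + real (card S) * K" (is "\<exists>y\<in>M. ?P y")
      proof (rule finite_helly[OF S(2) M])
        show "contr (fst q)" if "q \<in> S" for q using S(1) that unfolding halfspaces_def by auto
        show "\<exists>x\<in>M. fst q x \<le> snd q + (3 * K + 1) \<and> fst q' x \<le> snd q' + (3 * K + 1)"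
          if "q \<in> S" "q' \<in> S" for q q'
          using halfspaces_meet[OF f, of "fst q" "snd q" "fst q'" "snd q'"] S(1) that by auto
      qed
      then obtain y where y: "y \<in> M" "?P y" by blast
      have "real (card S) * K \<le> real (2 * n) * K" using S(3) K_pos by (intro mult_right_mono) auto
      then have "fst q y \<le> snd q + C" if "q \<in> S" for q
        using y(2)[rule_format, OF that] unfolding C_def by linarith
      then show ?thesis using y(1) by blast
    qed
    have cover: "\<exists>S\<subseteq>halfspaces f. finite S \<and> card S < n \<and>
      (\<forall>q\<in>halfspaces f. snd q + T \<le> fst q a \<longrightarrow>
        (\<exists>q'\<in>S. \<forall>x\<in>M. fst q' x \<le> snd q' + C \<longrightarrow> fst q x \<le> snd q + T))" if "a \<in> M" for a
      using deep_halfspaces_cover[OF rank \<Lambda> f that C] unfolding T_def .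
    obtain a where a: "a \<in> M" using M by blast
    obtain S where S: "S \<subseteq> halfspaces f" "finite S" "card S < n"
      "\<And>q. q \<in> halfspaces f \<Longrightarrow> snd q + T \<le> fst q a \<Longrightarrow>
        \<exists>q'\<in>S. \<forall>x\<in>M. fst q' x \<le> snd q' + C \<longrightarrow> fst q x \<le> snd q + T"
      using cover[OF a] by blast
    obtain y0 where y0: "y0 \<in> M" "\<forall>q\<in>S. fst q y0 \<le> snd q + C" using common[of S] S by auto
    obtain S' where S': "S' \<subseteq> halfspaces f" "finite S'" "card S' < n"
      "\<And>q. q \<in> halfspaces f \<Longrightarrow> snd q + T \<le> fst q y0 \<Longrightarrow>
        \<exists>q'\<in>S'. \<forall>x\<in>M. fst q' x \<le> snd q' + C \<longrightarrow> fst q x \<le> snd q + T"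
      using cover[OF y0(1)] by blast
    have "card (S \<union> S') \<le> 2 * n" using card_Un_le[of S S'] S S' by linarith
    then obtain y where y: "y \<in> M" "\<forall>q\<in>S \<union> S'. fst q y \<le> snd q + C"
      using common[of "S \<union> S'"] S S' by auto
    let ?y = "\<mu> a y0 y"
    have key: "\<Phi> ?y \<le> c + T + K" if q: "(\<Phi>, c) \<in> halfspaces f" for \<Phi> c
    proof (rule contr_median_le[OF _ a y0(1) y(1)])
      show "contr \<Phi>" using q unfolding halfspaces_def by auto
      have 1: "\<Phi> y0 \<le> c + T \<and> \<Phi> y \<le> c + T" if "c + T \<le> \<Phi> a"
        using S(4)[OF q] that y0 y by fastforce
      have 2: "\<Phi> y \<le> c + T" if "c + T \<le> \<Phi> y0"
        using S'(4)[OF q] that y by fastforce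
      show "\<Phi> a \<le> c + T \<and> \<Phi> y0 \<le> c + T \<or> \<Phi> a \<le> c + T \<and> \<Phi> y \<le> c + T \<or> \<Phi> y0 \<le> c + T \<and> \<Phi> y \<le> c + T"
        using 1 2 by linarith
    qed
    have yM: "?y \<in> M" using median_closed a y0 y by blast
    have "\<sigma> ?y x \<le> f x + (T + K)" if x: "x \<in> M" for x
      unfolding \<sigma>_commute[of ?y]
    proof (rule \<sigma>_le[OF x yM])
      fix \<Phi> assume "contr \<Phi>"
      then have "(\<Phi>, \<Phi> x + f x) \<in> halfspaces f" using x unfolding halfspaces_def by auto
      from key[OF this] show "\<Phi> ?y - \<Phi> x \<le> f x + (T + K)" by linarith
    qed
    then show ?thesis using yM by blast
  qed
  moreover have "0 \<le> T + K" using C T K_pos by linarith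
  ultimately show ?thesis by blast
qed

subsection \<open>Extremal functions\<close>

text \<open>For a radius function f this is the least g with
  \<open>\<sigma> x z \<le> g x + f z\<close>, and f is extremal when it agrees with it.\<close>

definition conjugate :: "('a \<Rightarrow> real) \<Rightarrow> 'a \<Rightarrow> real" where
  "conjugate f x = (SUP z\<in>M. \<sigma> x z - f z)"

text \<open>The mean is taken because the conjugate alone need not be a radius function: its
  inequality pairs it with f, not with itself.\<close>

definition improve :: "('a \<Rightarrow> real) \<Rightarrow> 'a \<Rightarrow> real" where
  "improve f x = (f x + conjugate f x) / 2"

text \<open>Dress's canonical retraction onto the injective hull: its values are the extremal functions.\<close>

definition extremal :: "('a \<Rightarrow> real) \<Rightarrow> 'a \<Rightarrow> real" where
  "extremal f x = lim (\<lambda>n. (improve ^^ n) f x)"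

lemma conjugate_upper:
  assumes "radius_function f" "x \<in> M" "z \<in> M"
  shows "\<sigma> x z - f z \<le> conjugate f x"
proof -
  have "bdd_above ((\<lambda>z. \<sigma> x z - f z) ` M)"
  proof (rule bdd_aboveI2)
    show "\<sigma> x z - f z \<le> f x" if "z \<in> M" for z using radius_functionD[OF assms(1,2) that] by linarith
  qed
  then show ?thesis unfolding conjugate_def using assms by (intro cSUP_upper)
qed

lemma conjugate_least:
  assumes "x \<in> M" "\<And>z. z \<in> M \<Longrightarrow> \<sigma> x z - f z \<le> B"
  shows "conjugate f x \<le> B"
  unfolding conjugate_def using assms by (intro cSUP_least) auto

lemma conjugate_le:
  assumes "radius_function f" "x \<in> M"
  shows "conjugate f x \<le> f x"
proof (rule conjugate_least[OF assms(2)])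
  show "\<sigma> x z - f z \<le> f x" if "z \<in> M" for z using radius_functionD[OF assms that] by linarith
qed

lemma improve_le: "radius_function f \<Longrightarrow> x \<in> M \<Longrightarrow> improve f x \<le> f x"
  using conjugate_le[of f x] by (simp add: improve_def)

lemma radius_function_improve:
  assumes "radius_function f"
  shows "radius_function (improve f)"
  unfolding radius_function_def
proof (intro ballI)
  fix x y assume xy: "x \<in> M" "y \<in> M"
  show "\<sigma> x y \<le> improve f x + improve f y"
    using conjugate_upper[OF assms xy] conjugate_upper[OF assms xy(2,1)] \<sigma>_commute[of x y]
    unfolding improve_def by (simp add: field_simps)
qed

lemma improve_iterate:
  "(improve ^^ Suc n) f x = ((improve ^^ n) f x + conjugate ((improve ^^ n) f) x) / 2"
  by (simp add: improve_def[of "(improve ^^ n) f" x])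

lemma radius_function_iterate: "radius_function f \<Longrightarrow> radius_function ((improve ^^ n) f)"
  by (induction n) (simp_all add: radius_function_improve)

lemma iterate_decseq:
  assumes "radius_function f" "x \<in> M"
  shows "decseq (\<lambda>n. (improve ^^ n) f x)"
  using improve_le[OF radius_function_iterate[OF assms(1)] assms(2)] by (intro decseq_SucI) simp

lemma extremal_tendsto:
  assumes "radius_function f" "x \<in> M"
  shows "(\<lambda>n. (improve ^^ n) f x) \<longlonglongrightarrow> extremal f x"
proof -
  have "\<exists>L. (\<lambda>n. (improve ^^ n) f x) \<longlonglongrightarrow> L"
    using decseq_convergent[OF iterate_decseq[OF assms], of 0]
      radius_function_nonneg[OF radius_function_iterate[OF assms(1)] assms(2)] by metis
  then show ?thesis unfolding extremal_def by (simp add: convergent_LIMSEQ_iff[symmetric] convergent_def)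
qed

lemma extremal_le_iterate:
  assumes "radius_function f" "x \<in> M"
  shows "extremal f x \<le> (improve ^^ n) f x"
  by (rule decseq_ge[OF iterate_decseq extremal_tendsto]) (rule assms)+

lemma extremal_le: "radius_function f \<Longrightarrow> x \<in> M \<Longrightarrow> extremal f x \<le> f x"
  using extremal_le_iterate[of f x 0] by simp

lemma radius_function_extremal:
  assumes "radius_function f"
  shows "radius_function (extremal f)"
  unfolding radius_function_def
proof (intro ballI)
  fix x y assume xy: "x \<in> M" "y \<in> M"
  show "\<sigma> x y \<le> extremal f x + extremal f y"
  proof (rule LIMSEQ_le_const)
    show "(\<lambda>n. (improve ^^ n) f x + (improve ^^ n) f y) \<longlonglongrightarrow> extremal f x + extremal f y"
      by (intro tendsto_add extremal_tendsto assms xy)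
    show "\<exists>N. \<forall>n\<ge>N. \<sigma> x y \<le> (improve ^^ n) f x + (improve ^^ n) f y"
      using radius_functionD[OF radius_function_iterate[OF assms] xy] by blast
  qed
qed

text \<open>The conjugate of an iterate is twice the next iterate minus the iterate, so it tends to
  the limit function; and it stays below the conjugate of the limit, since conjugation reverses
  order and the iterates decrease.\<close>

lemma extremal_le_conjugate:
  assumes f: "radius_function f" and x: "x \<in> M"
  shows "extremal f x \<le> conjugate (extremal f) x"
proof (rule LIMSEQ_le_const2)
  show "(\<lambda>n. 2 * (improve ^^ Suc n) f x - (improve ^^ n) f x) \<longlonglongrightarrow> extremal f x"
  proof -
    have "(\<lambda>n. 2 * (improve ^^ Suc n) f x - (improve ^^ n) f x) \<longlonglongrightarrow> 2 * extremal f x - extremal f x"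
      by (intro tendsto_diff tendsto_mult tendsto_const LIMSEQ_Suc[OF extremal_tendsto] extremal_tendsto assms)
    then show ?thesis by simp
  qed
  have "2 * (improve ^^ Suc n) f x - (improve ^^ n) f x \<le> conjugate (extremal f) x" for n
  proof -
    have "conjugate ((improve ^^ n) f) x \<le> conjugate (extremal f) x"
    proof (rule conjugate_least[OF x])
      fix z assume z: "z \<in> M"
      show "\<sigma> x z - (improve ^^ n) f z \<le> conjugate (extremal f) x"
        using conjugate_upper[OF radius_function_extremal[OF f] x z] extremal_le_iterate[OF f z, of n] by linarith
    qed
    then show ?thesis unfolding improve_iterate by (simp add: field_simps)
  qed
  then show "\<exists>N. \<forall>n\<ge>N. 2 * (improve ^^ Suc n) f x - (improve ^^ n) f x \<le> conjugate (extremal f) x" by blast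
qed

text \<open>Conjugation is nonexpansive for the supremum norm, hence so is each averaged step. This
  carries the conical inequality from mixtures of distance functions over to the hull.\<close>

lemma iterate_le_add:
  assumes f: "radius_function f" and f': "radius_function f'"
    and r: "\<And>x. x \<in> M \<Longrightarrow> \<bar>f x - f' x\<bar> \<le> r" and x: "x \<in> M"
  shows "\<bar>(improve ^^ n) f x - (improve ^^ n) f' x\<bar> \<le> r"
  using x
proof (induction n arbitrary: x)
  case (Suc n)
  have le: "conjugate h x \<le> conjugate h' x + r"
    if h: "radius_function h'" and close: "\<And>z. z \<in> M \<Longrightarrow> \<bar>h z - h' z\<bar> \<le> r" for h h'
  proof (rule conjugate_least[OF Suc.prems])
    fix z assume z: "z \<in> M"
    show "\<sigma> x z - h z \<le> conjugate h' x + r"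
      using conjugate_upper[OF h Suc.prems z] close[OF z] by linarith
  qed
  have "conjugate ((improve ^^ n) f) x \<le> conjugate ((improve ^^ n) f') x + r"
    "conjugate ((improve ^^ n) f') x \<le> conjugate ((improve ^^ n) f) x + r"
    using Suc.IH by (auto intro!: le radius_function_iterate f f' simp: abs_minus_commute)
  then show ?case using Suc.IH[OF Suc.prems] unfolding improve_iterate by (simp add: field_simps abs_le_iff)
qed (use r in auto)

lemma extremal_le_add:
  assumes f: "radius_function f" and f': "radius_function f'"
    and r: "\<And>x. x \<in> M \<Longrightarrow> \<bar>f x - f' x\<bar> \<le> r" and x: "x \<in> M"
  shows "extremal f' x \<le> extremal f x + r"
proof (rule LIMSEQ_le[OF extremal_tendsto[OF f' x] tendsto_add[OF extremal_tendsto[OF f x] tendsto_const]])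
  show "\<exists>N. \<forall>n\<ge>N. (improve ^^ n) f' x \<le> (improve ^^ n) f x + r"
    using iterate_le_add[OF f f' r x] by (auto simp: abs_le_iff algebra_simps)
qed

text \<open>The iteration is defined from \<sigma> without choices, so isometries commute with it;
  minimal functions supplied by Zorn's lemma need not be equivariant.\<close>

lemma extremal_equivariant:
  assumes g: "bij_betw g M M" and iso: "\<And>x y. x \<in> M \<Longrightarrow> y \<in> M \<Longrightarrow> \<sigma> (g x) (g y) = \<sigma> x y"
    and eq: "\<And>x. x \<in> M \<Longrightarrow> f' (g x) = f x" and x: "x \<in> M"
  shows "extremal f' (g x) = extremal f x"
proof -
  have "(improve ^^ n) f' (g x) = (improve ^^ n) f x" if "x \<in> M" for n x
    using that
  proof (induction n arbitrary: x)
    case (Suc n)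
    have "conjugate ((improve ^^ n) f') (g x) = (SUP z\<in>g ` M. \<sigma> (g x) z - (improve ^^ n) f' z)"
      using g by (simp add: conjugate_def bij_betw_def)
    also have "\<dots> = conjugate ((improve ^^ n) f) x"
      unfolding image_image conjugate_def using Suc iso by (intro SUP_cong) auto
    finally show ?case using Suc unfolding improve_iterate by simp
  qed (use eq in auto)
  then show ?thesis using x by (simp add: extremal_def)
qed

text \<open>Coarse injectivity means that points are coarsely dense among the extremal functions.\<close>

definition represents :: "real \<Rightarrow> ('a \<Rightarrow> real) \<Rightarrow> 'a \<Rightarrow> bool" where
  "represents \<delta> f y \<longleftrightarrow> y \<in> M \<and> (\<forall>x\<in>M. \<bar>\<sigma> y x - extremal f x\<bar> \<le> \<delta>)"

text \<open>The upper bound suffices: by the triangle inequality it bounds the conjugate of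
  \<open>extremal f\<close> by \<open>\<sigma> y\<close> plus \<delta>, and that conjugate dominates
  \<open>extremal f\<close>.\<close>

lemma representsI:
  assumes f: "radius_function f" and y: "y \<in> M" "\<And>x. x \<in> M \<Longrightarrow> \<sigma> y x \<le> extremal f x + \<delta>"
  shows "represents \<delta> f y"
  unfolding represents_def
proof (intro conjI ballI y)
  fix x assume x: "x \<in> M"
  have "conjugate (extremal f) x \<le> \<sigma> y x + \<delta>"
  proof (rule conjugate_least[OF x])
    fix z assume z: "z \<in> M"
    have "\<sigma> x z \<le> \<sigma> x y + \<sigma> y z" using Metric_space.triangle[OF \<sigma>_metric x y(1) z] .
    then show "\<sigma> x z - extremal f z \<le> \<sigma> y x + \<delta>" using y(2)[OF z] \<sigma>_commute[of x y] by linarith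
  qed
  then show "\<bar>\<sigma> y x - extremal f x\<bar> \<le> \<delta>"
    using extremal_le_conjugate[OF f x] y(2)[OF x] by linarith
qed

text \<open>Distance functions are already extremal: the retraction of \<open>\<sigma> a\<close> is
  at most 0 at a, which forces its value at x to be at least \<open>\<sigma> a x\<close>. This
  permits exact endpoints of the combing lines.\<close>

lemma represents_point:
  assumes a: "a \<in> M" and \<delta>: "0 \<le> \<delta>"
  shows "represents \<delta> (\<sigma> a) a"
proof (rule representsI[OF _ a])
  show f: "radius_function (\<sigma> a)"
    unfolding radius_function_def
  proof (intro ballI)
    fix x y assume "x \<in> M" "y \<in> M"
    then show "\<sigma> x y \<le> \<sigma> a x + \<sigma> a y"
      using Metric_space.triangle[OF \<sigma>_metric _ a, of x y] \<sigma>_commute[of x a] by auto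
  qed
  fix x assume x: "x \<in> M"
  have "extremal (\<sigma> a) a \<le> \<sigma> a a" by (rule extremal_le[OF f a])
  also have "\<sigma> a a = 0" using Metric_space.mdist_zero[OF \<sigma>_metric a] by simp
  finally show "\<sigma> a x \<le> extremal (\<sigma> a) x + \<delta>"
    using radius_functionD[OF radius_function_extremal[OF f] a x] \<delta> by linarith
qed

text \<open>It is enough to evaluate at y: \<open>extremal f\<close> is at most \<delta> there,
  \<open>extremal f'\<close> at most r more, and \<open>\<sigma> y' y\<close> exceeds the latter by
  at most \<delta>.\<close>

lemma represents_close:
  assumes f: "radius_function f" and f': "radius_function f'"
    and r: "\<And>x. x \<in> M \<Longrightarrow> \<bar>f x - f' x\<bar> \<le> r" and y: "represents \<delta> f y" and y': "represents \<delta> f' y'"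
  shows "\<sigma> y y' \<le> r + 2 * \<delta>"
proof -
  have M: "y \<in> M" "y' \<in> M" using y y' by (auto simp: represents_def)
  have "\<bar>\<sigma> y y - extremal f y\<bar> \<le> \<delta>" "\<bar>\<sigma> y' y - extremal f' y\<bar> \<le> \<delta>"
    using y y' M by (auto simp: represents_def)
  moreover have "\<sigma> y y = 0" using Metric_space.mdist_zero[OF \<sigma>_metric M(1)] by simp
  moreover have "extremal f' y \<le> extremal f y + r" by (rule extremal_le_add[OF f f' r M(1)])
  ultimately show ?thesis using \<sigma>_commute[of y y'] by linarith
qed

subsection \<open>The bicombing\<close>

definition mix :: "'a \<Rightarrow> 'a \<Rightarrow> real \<Rightarrow> 'a \<Rightarrow> real" where
  "mix a b t x = (1 - t) * \<sigma> a x + t * \<sigma> b x"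

lemma radius_function_mix:
  assumes "a \<in> M" "b \<in> M" "t \<in> {0..1}"
  shows "radius_function (mix a b t)"
  unfolding radius_function_def
proof (intro ballI)
  fix x y assume xy: "x \<in> M" "y \<in> M"
  have tri: "\<sigma> x y \<le> \<sigma> c x + \<sigma> c y" if "c \<in> M" for c
    using Metric_space.triangle[OF \<sigma>_metric xy(1) that xy(2)] \<sigma>_commute[of x c] by simp
  have "(1 - t) * \<sigma> x y \<le> (1 - t) * (\<sigma> a x + \<sigma> a y)" "t * \<sigma> x y \<le> t * (\<sigma> b x + \<sigma> b y)"
    using assms tri by (auto intro!: mult_left_mono)
  then show "\<sigma> x y \<le> mix a b t x + mix a b t y" unfolding mix_def by (simp add: algebra_simps)
qed

lemma mix_diff:
  assumes "a \<in> M" "b \<in> M" "a' \<in> M" "b' \<in> M" "t \<in> {0..1}" "x \<in> M"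
  shows "\<bar>mix a b t x - mix a' b' t x\<bar> \<le> (1 - t) * \<sigma> a a' + t * \<sigma> b b'"
proof -
  have tri: "\<bar>\<sigma> c x - \<sigma> c' x\<bar> \<le> \<sigma> c c'" if "c \<in> M" "c' \<in> M" for c c'
    using Metric_space.triangle[OF \<sigma>_metric that(1,2) assms(6)]
      Metric_space.triangle[OF \<sigma>_metric that(2,1) assms(6)] \<sigma>_commute[of c c'] by linarith
  have "\<bar>mix a b t x - mix a' b' t x\<bar> = \<bar>(1 - t) * (\<sigma> a x - \<sigma> a' x) + t * (\<sigma> b x - \<sigma> b' x)\<bar>"
    by (simp add: mix_def algebra_simps)
  also have "\<dots> \<le> (1 - t) * \<bar>\<sigma> a x - \<sigma> a' x\<bar> + t * \<bar>\<sigma> b x - \<sigma> b' x\<bar>"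
    using assms(5) by (intro order_trans[OF abs_triangle_ineq]) (simp add: abs_mult)
  also have "\<dots> \<le> (1 - t) * \<sigma> a a' + t * \<sigma> b b'"
    using assms tri by (intro add_mono mult_left_mono) auto
  finally show ?thesis .
qed

lemma mix_diff_time:
  assumes "a \<in> M" "b \<in> M" "x \<in> M"
  shows "\<bar>mix a b s x - mix a b t x\<bar> \<le> \<bar>s - t\<bar> * \<sigma> a b"
proof -
  have "\<bar>\<sigma> b x - \<sigma> a x\<bar> \<le> \<sigma> a b"
    using Metric_space.triangle[OF \<sigma>_metric assms(1,2,3)]
      Metric_space.triangle[OF \<sigma>_metric assms(2,1,3)] \<sigma>_commute[of a b] by linarith
  moreover have "mix a b s x - mix a b t x = (s - t) * (\<sigma> b x - \<sigma> a x)" by (simp add: mix_def algebra_simps)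
  ultimately show ?thesis by (simp add: abs_mult mult_left_mono)
qed

theorem exists_bicombing:
  assumes rank: "rank_lt n \<Lambda>" and \<Lambda>: "0 \<le> \<Lambda>"
    and act: "\<And>g. g \<in> G \<Longrightarrow> isometry_between M d M d (act g)"
    and equiv: "\<And>g x y z. g \<in> G \<Longrightarrow> x \<in> M \<Longrightarrow> y \<in> M \<Longrightarrow> z \<in> M \<Longrightarrow>
      \<mu> (act g x) (act g y) (act g z) = act g (\<mu> x y z)"
  shows "\<exists>\<gamma>. quasigeodesic_bicombing M \<sigma> \<gamma> \<and> rough_geodesic_lines M \<sigma> \<gamma> \<and> roughly_conical M \<sigma> \<gamma> \<and>
    roughly_reversible M \<sigma> \<gamma> \<and> coarsely_equivariant G act M \<sigma> \<gamma>"
proof (cases "M = {}")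
  case True
  then show ?thesis
    using \<sigma>_metric
    by (auto simp: quasigeodesic_bicombing_def rough_geodesic_lines_def roughly_conical_def
        roughly_reversible_def coarsely_equivariant_def intro!: exI[of _ 1])
next
  case False
  obtain \<delta> where \<delta>: "0 \<le> \<delta>" "\<And>f. radius_function f \<Longrightarrow> \<exists>y\<in>M. \<forall>x\<in>M. \<sigma> y x \<le> f x + \<delta>"
    using coarse_injectivity[OF rank \<Lambda> False] by blast
  have ex: "\<exists>y. represents \<delta> f y" if f: "radius_function f" for f
    using \<delta>(2)[OF radius_function_extremal[OF f]] representsI[OF f] by blast
  \<comment> \<open>The endpoints have to be attained exactly and are therefore prescribed; any
    representing point will do in between, at the cost of an error in equivariance.\<close>
  define \<gamma> where "\<gamma> = (\<lambda>a b t. if t = 0 then a else if t = 1 then b else SOME y. represents \<delta> (mix a b t) y)"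
  have \<gamma>: "represents \<delta> (mix a b t) (\<gamma> a b t)" if "a \<in> M" "b \<in> M" "t \<in> {0..1}" for a b t
  proof -
    have "mix a b 0 = \<sigma> a" "mix a b 1 = \<sigma> b" by (auto simp: mix_def)
    then show ?thesis
      using represents_point[OF that(1) \<delta>(1)] represents_point[OF that(2) \<delta>(1)]
        someI_ex[OF ex[OF radius_function_mix[OF that]]] by (auto simp: \<gamma>_def)
  qed
  have \<gamma>M: "\<gamma> a b t \<in> M" if "a \<in> M" "b \<in> M" "t \<in> {0..1}" for a b t
    using \<gamma>[OF that] by (simp add: represents_def)
  note tri = Metric_space.triangle[OF \<sigma>_metric]
  have upper: "\<sigma> (\<gamma> a b s) (\<gamma> a b t) \<le> \<bar>s - t\<bar> * \<sigma> a b + 2 * \<delta>"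
    if "a \<in> M" "b \<in> M" "s \<in> {0..1}" "t \<in> {0..1}" for a b s t
    by (rule represents_close[OF radius_function_mix radius_function_mix mix_diff_time \<gamma> \<gamma>])
      (use that in auto)
  \<comment> \<open>The pieces from a to the first point and from the second point to b are too long
    by at most 2 * \<delta> each; the triangle inequality leaves the rest for the middle
    piece.\<close>
  have lower: "\<bar>s - t\<bar> * \<sigma> a b - 4 * \<delta> \<le> \<sigma> (\<gamma> a b s) (\<gamma> a b t)"
    if ab: "a \<in> M" "b \<in> M" and st: "s \<in> {0..1}" "t \<in> {0..1}" for a b s t
  proof -
    have *: "(t - s) * \<sigma> a b - 4 * \<delta> \<le> \<sigma> (\<gamma> a b s) (\<gamma> a b t)"
      if st: "s \<in> {0..1}" "t \<in> {0..1}" for s t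
    proof -
      have e: "\<gamma> a b 0 = a" "\<gamma> a b 1 = b" by (auto simp: \<gamma>_def)
      have "\<sigma> a (\<gamma> a b s) \<le> s * \<sigma> a b + 2 * \<delta>" "\<sigma> (\<gamma> a b t) b \<le> (1 - t) * \<sigma> a b + 2 * \<delta>"
        using upper[OF ab, of 0 s] upper[OF ab, of t 1] st unfolding e by auto
      moreover have "\<sigma> a b \<le> \<sigma> a (\<gamma> a b s) + \<sigma> (\<gamma> a b s) b"
        "\<sigma> (\<gamma> a b s) b \<le> \<sigma> (\<gamma> a b s) (\<gamma> a b t) + \<sigma> (\<gamma> a b t) b"
        using tri ab \<gamma>M[OF ab] st by auto
      ultimately have "\<sigma> a b \<le> s * \<sigma> a b + (1 - t) * \<sigma> a b + 4 * \<delta> + \<sigma> (\<gamma> a b s) (\<gamma> a b t)" by linarith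
      then show ?thesis by (simp add: algebra_simps)
    qed
    show ?thesis
      using *[OF st] *[OF st(2,1)] \<sigma>_commute[of "\<gamma> a b s" "\<gamma> a b t"] by (cases "s \<le> t") auto
  qed
  have qi: "qi_embedding 1 (4 * \<delta>) M \<sigma> (\<sigma> a b) (\<lambda>t. \<gamma> a b (t / \<sigma> a b))"
    and pos: "\<sigma> a b > 0" if ab: "a \<in> M" "b \<in> M" "a \<noteq> b" for a b
  proof -
    show pos: "\<sigma> a b > 0"
      using Metric_space.mdist_pos_less[OF \<sigma>_metric ab(3,1,2)] .
    have unit: "t / \<sigma> a b \<in> {0..1}" if "t \<in> {0..\<sigma> a b}" for t using that pos by auto
    have scale: "\<bar>s / \<sigma> a b - t / \<sigma> a b\<bar> * \<sigma> a b = \<bar>s - t\<bar>" for s t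
      using pos by (simp add: diff_divide_distrib[symmetric] abs_divide)
    show "qi_embedding 1 (4 * \<delta>) M \<sigma> (\<sigma> a b) (\<lambda>t. \<gamma> a b (t / \<sigma> a b))"
      unfolding qi_embedding_def
    proof (intro conjI ballI)
      show "(\<lambda>t. \<gamma> a b (t / \<sigma> a b)) ` {0..\<sigma> a b} \<subseteq> M" using \<gamma>M[OF ab(1,2) unit] by auto
      fix s t assume st: "s \<in> {0..\<sigma> a b}" "t \<in> {0..\<sigma> a b}"
      show "\<bar>s - t\<bar> / 1 - 4 * \<delta> \<le> \<sigma> (\<gamma> a b (s / \<sigma> a b)) (\<gamma> a b (t / \<sigma> a b))"
        using lower[OF ab(1,2) unit[OF st(1)] unit[OF st(2)]] unfolding scale by simp
      show "\<sigma> (\<gamma> a b (s / \<sigma> a b)) (\<gamma> a b (t / \<sigma> a b)) \<le> 1 * \<bar>s - t\<bar> + 4 * \<delta>"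
        using upper[OF ab(1,2) unit[OF st(1)] unit[OF st(2)]] \<delta>(1) unfolding scale by simp
    qed
  qed
  have "quasigeodesic_bicombing M \<sigma> \<gamma>"
    unfolding quasigeodesic_bicombing_def
  proof (intro conjI)
    have "quasigeodesic 1 (4 * \<delta>) M \<sigma> a b (\<sigma> a b) (\<lambda>t. \<gamma> a b (t / \<sigma> a b))"
      if "a \<in> M" "b \<in> M" "a \<noteq> b" for a b
      using qi[OF that] pos[OF that] by (simp add: quasigeodesic_def \<gamma>_def)
    then show "\<exists>k\<ge>1. \<exists>c\<ge>0. \<forall>a\<in>M. \<forall>b\<in>M. a \<noteq> b \<longrightarrow>
        quasigeodesic k c M \<sigma> a b (\<sigma> a b) (\<lambda>t. \<gamma> a b (t / \<sigma> a b))"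
      using \<delta>(1) by (intro exI[of _ "1 :: real"] conjI exI[of _ "4 * \<delta>"]) auto
  qed (use \<sigma>_metric \<gamma>M in auto)
  moreover have "rough_geodesic_lines M \<sigma> \<gamma>"
    unfolding rough_geodesic_lines_def using qi \<delta>(1) by (intro exI[of _ "4 * \<delta>"]) auto
  moreover have "roughly_conical M \<sigma> \<gamma>"
    unfolding roughly_conical_def
  proof (intro exI[of _ "2 * \<delta>"] conjI ballI)
    fix a b a' b' t assume *: "a \<in> M" "b \<in> M" "a' \<in> M" "b' \<in> M" "t \<in> {0..1::real}"
    show "\<sigma> (\<gamma> a b t) (\<gamma> a' b' t) \<le> (1 - t) * \<sigma> a a' + t * \<sigma> b b' + 2 * \<delta>"
      by (rule represents_close[OF radius_function_mix radius_function_mix mix_diff \<gamma> \<gamma>]) (use * in auto)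
  qed (use \<delta>(1) in auto)
  moreover have "roughly_reversible M \<sigma> \<gamma>"
    unfolding roughly_reversible_def
  \<comment> \<open>The mixtures for a, b, t and for b, a, 1 - t coincide, so
    \<open>represents_close\<close> applies with r = 0.\<close>
  proof (intro exI[of _ "0 + 2 * \<delta>"] conjI ballI)
    fix a b t assume *: "a \<in> M" "b \<in> M" "t \<in> {0..1::real}"
    show "\<sigma> (\<gamma> a b t) (\<gamma> b a (1 - t)) \<le> 0 + 2 * \<delta>"
      by (rule represents_close[OF radius_function_mix radius_function_mix _ \<gamma> \<gamma>])
        (use * in \<open>auto simp: mix_def\<close>)
  qed (use \<delta>(1) in auto)
  moreover have "coarsely_equivariant G act M \<sigma> \<gamma>"
    unfolding coarsely_equivariant_def
  proof (intro exI[of _ "2 * \<delta>"] conjI ballI)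
    fix g a b t assume *: "g \<in> G" "a \<in> M" "b \<in> M" "t \<in> {0..1::real}"
    have bij: "bij_betw (act g) M M" using act[OF *(1)] by (simp add: isometry_between_def)
    then have gM: "act g x \<in> M" if "x \<in> M" for x using that by (auto simp: bij_betw_def)
    have iso: "\<sigma> (act g x) (act g y) = \<sigma> x y" if "x \<in> M" "y \<in> M" for x y
      by (rule \<sigma>_isometry[OF act[OF *(1)] equiv[OF *(1)] that])
    let ?y = "\<gamma> a b t" and ?y' = "\<gamma> (act g a) (act g b) t"
    have y: "represents \<delta> (mix a b t) ?y" by (rule \<gamma>[OF *(2-4)])
    have y': "represents \<delta> (mix (act g a) (act g b) t) ?y'" by (rule \<gamma>[OF gM[OF *(2)] gM[OF *(3)] *(4)])
    have yM: "?y \<in> M" by (rule \<gamma>M[OF *(2-4)])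
    \<comment> \<open>The hull point of the translated pair thus has value at most \<delta> at the
      translate of \<open>?y\<close>, and \<open>?y'\<close> represents this hull point.\<close>
    have "extremal (mix (act g a) (act g b) t) (act g ?y) = extremal (mix a b t) ?y"
      by (rule extremal_equivariant[OF bij iso _ yM]) (use iso * in \<open>auto simp: mix_def\<close>)
    moreover have "\<bar>\<sigma> ?y ?y - extremal (mix a b t) ?y\<bar> \<le> \<delta>"
      using y yM by (auto simp: represents_def)
    moreover have "\<sigma> ?y ?y = 0" using Metric_space.mdist_zero[OF \<sigma>_metric yM] by simp
    moreover have "\<bar>\<sigma> ?y' (act g ?y) - extremal (mix (act g a) (act g b) t) (act g ?y)\<bar> \<le> \<delta>"
      using y' gM[OF yM] by (auto simp: represents_def)
    ultimately show "\<sigma> (act g ?y) ?y' \<le> 2 * \<delta>" using \<sigma>_commute[of "act g ?y" ?y'] by linarith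
  qed (use \<delta>(1) in auto)
  ultimately show ?thesis by blast
qed

end

section \<open>Rank of hierarchically hyperbolic spaces\<close>

text \<open>The infimum need not be attained; the slack of 1 reappears as E + 1 and 3E + 2 in the
  estimates for domains.\<close>

lemma set_distance_leD:
  assumes "set_distance d A B \<le> r" "A \<noteq> {}" "B \<noteq> {}"
  shows "\<exists>a\<in>A. \<exists>b\<in>B. d a b < r + 1"
proof (rule ccontr)
  assume "\<not> ?thesis"
  then have "r + 1 \<le> set_distance d A B"
    unfolding set_distance_def using assms by (intro cINF_greatest) force+
  then show False using assms by linarith
qed

lemma less_set_distance:
  assumes "A \<noteq> {}" "B \<noteq> {}" "\<And>a b. a \<in> A \<Longrightarrow> b \<in> B \<Longrightarrow> r + 1 \<le> d a b"
  shows "r < set_distance d A B"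
proof -
  have "r + 1 \<le> set_distance d A B"
    unfolding set_distance_def using assms by (intro cINF_greatest) auto
  then show ?thesis by linarith
qed

text \<open>The axiom speaks of a unique maximal element. From a domain not nested in it one could
  climb for ever, as no other domain is maximal, and the chain would outgrow E.\<close>

lemma exists_top_domain:
  assumes nest: "hhs_nesting E H" and fc: "hhs_finite_complexity E H" and ne: "domains H \<noteq> {}"
  shows "\<exists>S\<in>domains H. \<forall>U\<in>domains H. nested H U S"
proof -
  obtain S where S: "S \<in> domains H"
    and uniq: "\<And>T. T \<in> domains H \<Longrightarrow> (\<forall>V\<in>domains H. nested H T V \<longrightarrow> V = T) \<Longrightarrow> T = S"
    using nest ne unfolding hhs_nesting_def by metis
  have refl: "nested H U U" if "U \<in> domains H" for U
    using nest that unfolding hhs_nesting_def by blast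
  have antisym: "U = V" if "U \<in> domains H" "V \<in> domains H" "nested H U V" "nested H V U" for U V
    using nest that unfolding hhs_nesting_def by blast
  have trans: "nested H U W" if "U \<in> domains H" "V \<in> domains H" "W \<in> domains H" "nested H U V" "nested H V W" for U V W
    using nest that unfolding hhs_nesting_def by blast
  have "nested H U S" if U: "U \<in> domains H" for U
  proof (rule ccontr)
    assume no: "\<not> nested H U S"
    have "\<exists>A T. A \<subseteq> domains H \<and> finite A \<and> card A = Suc k \<and> (\<forall>V\<in>A. \<forall>W\<in>A. nested H V W \<or> nested H W V) \<and>
       T \<in> domains H \<and> nested H U T \<and> (\<forall>V\<in>A. nested H V T)" for k
    proof (induction k)
      case 0
      show ?case by (rule exI[of _ "{U}"], rule exI[of _ U]) (use U refl in auto)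
    next
      case (Suc k)
      then obtain A T where A: "A \<subseteq> domains H" "finite A" "card A = Suc k"
        "\<forall>V\<in>A. \<forall>W\<in>A. nested H V W \<or> nested H W V"
        and T: "T \<in> domains H" "nested H U T" "\<forall>V\<in>A. nested H V T" by blast
      have "T \<noteq> S" using no T by blast
      then obtain V where V: "V \<in> domains H" "nested H T V" "V \<noteq> T" using uniq[OF T(1)] by blast
      have "V \<notin> A" using T V antisym by blast
      moreover have "nested H W V" if "W \<in> A" for W using trans[of W T V] that A T V by blast
      ultimately show ?case
        using A V T trans[OF U T(1) V(1) T(2) V(2)] refl[OF V(1)]
        by (intro exI[of _ "insert V A"] exI[of _ V]) auto
    qed
    from this[of "nat \<lceil>E\<rceil>"] obtain A where "A \<subseteq> domains H" "card A = Suc (nat \<lceil>E\<rceil>)"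
      "\<forall>V\<in>A. \<forall>W\<in>A. nested H V W \<or> nested H W V" by blast
    moreover from this have "real (card A) \<le> E" using fc unfolding hhs_finite_complexity_def by blast
    ultimately show False by linarith
  qed
  then show ?thesis using S by blast
qed

text \<open>The container axiom puts all members but one into some W properly nested in T, so T
  extends the chain obtained below W. For a single member the chain is T alone.\<close>

lemma orthogonal_family_chain:
  assumes nest: "hhs_nesting E H" and orth: "hhs_orthogonality H"
    and "T \<in> domains H" "\<U> \<subseteq> domains H" "finite \<U>" "\<forall>U\<in>\<U>. nested H U T"
    and "\<forall>U\<in>\<U>. \<forall>V\<in>\<U>. U \<noteq> V \<longrightarrow> orth H U V"
  shows "\<exists>A\<subseteq>domains H. finite A \<and> card A = card \<U> \<and>
    (\<forall>V\<in>A. \<forall>W\<in>A. nested H V W \<or> nested H W V) \<and> (\<forall>V\<in>A. nested H V T)"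
  using assms(3-)
proof (induction "card \<U>" arbitrary: \<U> T)
  case 0
  then show ?case by (intro exI[of _ "{}"]) auto
next
  case (Suc m)
  have refl: "nested H T T" using nest Suc.prems unfolding hhs_nesting_def by blast
  have antisym: "U = V" if "U \<in> domains H" "V \<in> domains H" "nested H U V" "nested H V U" for U V
    using nest that unfolding hhs_nesting_def by blast
  have trans: "nested H U W" if "U \<in> domains H" "V \<in> domains H" "W \<in> domains H" "nested H U V" "nested H V W" for U V W
    using nest that unfolding hhs_nesting_def by blast
  show ?case
  proof (cases "m = 0")
    case True
    then show ?thesis using Suc refl by (intro exI[of _ "{T}"]) auto
  next
    case False
    obtain U where U: "U \<in> \<U>" using Suc by fastforce
    then have m: "card (\<U> - {U}) = m" using Suc by simp
    then have "\<U> - {U} \<noteq> {}" using False by force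
    then obtain V where V: "V \<in> \<U>" "V \<noteq> U" by blast
    have dU: "U \<in> domains H" "nested H U T" using Suc.prems U by blast+
    have "V \<in> domains H" "nested H V T" "orth H V U" using Suc.prems U V by blast+
    then obtain W where W: "W \<in> domains H" "pnested H W T"
      "\<forall>V\<in>domains H. nested H V T \<and> orth H V U \<longrightarrow> nested H V W"
      using orth Suc.prems(1) dU unfolding hhs_orthogonality_def by meson
    have WT: "nested H W T" "W \<noteq> T" using W(2) by (auto simp: pnested_def)
    have "\<forall>V\<in>\<U> - {U}. nested H V W" using W(3) Suc.prems U by blast
    moreover have "\<U> - {U} \<subseteq> domains H" "finite (\<U> - {U})"
      "\<forall>V\<in>\<U> - {U}. \<forall>V'\<in>\<U> - {U}. V \<noteq> V' \<longrightarrow> orth H V V'"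
      using Suc.prems by blast+
    ultimately obtain A where A: "A \<subseteq> domains H" "finite A" "card A = m"
      "\<forall>V\<in>A. \<forall>W\<in>A. nested H V W \<or> nested H W V" "\<forall>V\<in>A. nested H V W"
      using Suc.hyps(1)[OF m[symmetric] W(1)] m by auto
    have "T \<notin> A" using A(5) W(1) WT antisym[OF W(1) Suc.prems(1)] by blast
    moreover have "nested H V T" if "V \<in> A" for V
      using that A(1,5) WT trans[OF _ W(1) Suc.prems(1)] by blast
    ultimately show ?thesis
      using A Suc.prems Suc.hyps(2) refl by (intro exI[of _ "insert T A"]) auto
  qed
qed

lemma card_orthogonal_family_le:
  assumes nest: "hhs_nesting E H" and orth: "hhs_orthogonality H" and fc: "hhs_finite_complexity E H"
    and U: "\<U> \<subseteq> domains H" "finite \<U>" "\<forall>U\<in>\<U>. \<forall>V\<in>\<U>. U \<noteq> V \<longrightarrow> orth H U V" and E: "0 \<le> E"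
  shows "real (card \<U>) \<le> E"
proof (cases "\<U> = {}")
  case False
  then obtain S where "S \<in> domains H" "\<forall>U\<in>domains H. nested H U S"
    using exists_top_domain[OF nest fc] U(1) by blast
  then obtain A where "A \<subseteq> domains H" "card A = card \<U>" "\<forall>V\<in>A. \<forall>W\<in>A. nested H V W \<or> nested H W V"
    using orthogonal_family_chain[OF nest orth _ U(1,2) _ U(3), of S] U(1) by blast
  then show ?thesis using fc unfolding hhs_finite_complexity_def by metis
qed (use E in auto)

section \<open>Coarse rectangles seen in two domains\<close>

lemma dproj_triangle:
  assumes "Metric_space (cspace H U) (cdist H U)" "hhs_projections E H" "U \<in> domains H"
    "x \<in> points H" "y \<in> points H" "z \<in> points H"
  shows "dproj H U x z \<le> dproj H U x y + dproj H U y z"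
proof -
  have "proj H U ` points H \<subseteq> cspace H U" using assms unfolding hhs_projections_def by blast
  then show ?thesis unfolding dproj_def using assms by (intro Metric_space.triangle) auto
qed

lemma near_same_set:
  assumes m: "Metric_space (cspace H U) (cdist H U)" and "proj H U x \<in> cspace H U" "proj H U y \<in> cspace H U"
    and A: "A \<subseteq> cspace H U" "diam_le (cdist H U) A E"
    and ab: "a \<in> A" "cdist H U (proj H U x) a \<le> s" "b \<in> A" "cdist H U (proj H U y) b \<le> t"
  shows "dproj H U x y \<le> s + E + t"
proof -
  interpret Metric_space "cspace H U" "cdist H U" by (rule m)
  have "a \<in> cspace H U" "b \<in> cspace H U" using A ab by auto
  then have "dproj H U x y \<le> cdist H U (proj H U x) a + cdist H U a (proj H U y)"
    "cdist H U a (proj H U y) \<le> cdist H U a b + cdist H U b (proj H U y)"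
    unfolding dproj_def using assms(2,3) by (auto intro: triangle)
  moreover have "cdist H U a b \<le> E" using A(2) ab unfolding diam_le_def by blast
  ultimately show ?thesis using ab(2,4) commute[of b] by simp
qed

text \<open>Bounded geodesic image: near \<open>x\<close> and \<open>y\<close> the map \<open>\<rho>\<^sup>V\<^sub>U\<close> is coarsely constant.\<close>

lemma close_if_far_from_rho:
  assumes H: "\<forall>U\<in>domains H. Metric_space (cspace H U) (cdist H U) \<and> geodesic_space (cspace H U) (cdist H U)"
    and hp: "hhs_projections E H" and hn: "hhs_nesting E H" and hc: "hhs_consistency E H"
    and hb: "hhs_bounded_geodesic_image E H"
    and U: "U \<in> domains H" "V \<in> domains H" "pnested H U V"
    and xy: "x \<in> points H" "y \<in> points H" "dproj H V x y \<le> C"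
    and far: "\<And>r. r \<in> rho H U V \<Longrightarrow> E + 1 + C \<le> cdist H V (proj H V x) r"
  shows "dproj H U x y \<le> 3 * E"
proof -
  interpret V: Metric_space "cspace H V" "cdist H V" using H U by blast
  interpret U: Metric_space "cspace H U" "cdist H U" using H U by blast
  have px: "proj H V x \<in> cspace H V" "proj H V y \<in> cspace H V" "proj H U x \<in> cspace H U" "proj H U y \<in> cspace H U"
    using hp U xy unfolding hhs_projections_def by blast+
  have rho: "rho H U V \<noteq> {}" "rho H U V \<subseteq> cspace H V" "rho_map H V U ` cspace H V \<subseteq> cspace H U"
    using hn U unfolding hhs_nesting_def by blast+
  obtain A where A: "geodesic_segment (cspace H V) (cdist H V) (proj H V x) (proj H V y) A"
    using H U px unfolding geodesic_space_def by blast
  note ends = V.geodesic_segment_endpoints[OF A px(1,2)]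
  have away: "E + 1 \<le> cdist H V q r" if q: "q \<in> A" and r: "r \<in> rho H U V" for q r
  proof -
    note qA = V.geodesic_segmentD[OF A q px(1,2)]
    have rV: "r \<in> cspace H V" using rho(2) r by blast
    have "cdist H V (proj H V x) r \<le> cdist H V (proj H V x) q + cdist H V q r"
      by (rule V.triangle[OF px(1) qA(1) rV])
    then show ?thesis
      using far[OF r] xy(3) qA(2) V.nonneg[of q "proj H V y"] unfolding dproj_def by linarith
  qed
  have "E < set_distance (cdist H V) A (rho H U V)"
    by (rule less_set_distance) (use ends rho(1) away in auto)
  then have "diam_le (cdist H U) (rho_map H V U ` A) E"
    using hb U px A unfolding hhs_bounded_geodesic_image_def by blast
  then have 1: "cdist H U (rho_map H V U (proj H V x)) (rho_map H V U (proj H V y)) \<le> E"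
    using ends unfolding diam_le_def by blast
  have near: "cdist H U (proj H U p) (rho_map H V U (proj H V p)) \<le> E"
    if p: "p \<in> points H" "proj H V p \<in> A" for p
  proof -
    have "E < dproj_set H V p (rho H U V)"
      unfolding dproj_set_def by (rule less_set_distance) (use rho(1) away p(2) in auto)
    moreover have "dproj_set H V p (rho H U V) \<le> E \<or>
        diam_le (cdist H U) {proj H U p, rho_map H V U (proj H V p)} E"
      using hc U p(1) unfolding hhs_consistency_def by blast
    ultimately have "diam_le (cdist H U) {proj H U p, rho_map H V U (proj H V p)} E" by linarith
    then show ?thesis unfolding diam_le_def by blast
  qed
  have r: "rho_map H V U (proj H V x) \<in> cspace H U" "rho_map H V U (proj H V y) \<in> cspace H U" using rho(3) px by auto
  have "dproj H U x y \<le> cdist H U (proj H U x) (rho_map H V U (proj H V x)) + cdist H U (rho_map H V U (proj H V x)) (proj H U y)"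
    "cdist H U (rho_map H V U (proj H V x)) (proj H U y) \<le> cdist H U (rho_map H V U (proj H V x)) (rho_map H V U (proj H V y)) +
      cdist H U (rho_map H V U (proj H V y)) (proj H U y)"
    unfolding dproj_def by (intro U.triangle px r)+
  \<comment> \<open>The three summands E come from consistency at x, the bounded geodesic image, and
    consistency at y.\<close>
  then show ?thesis
    using 1 near[OF xy(1) ends(1)] near[OF xy(2) ends(2)] U.commute[of "rho_map H V U (proj H V y)"] by simp
qed

text \<open>The edges from p to x and from y to z are short in V and long in U, so both pass near
  \<rho> in V. This set has diameter at most E, which bounds the distance of p and y in V by 2(E + 1
  + C) + E.\<close>

lemma rectangle_imp_not_pnested:
  assumes H: "\<forall>U\<in>domains H. Metric_space (cspace H U) (cdist H U) \<and> geodesic_space (cspace H U) (cdist H U)"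
    and hp: "hhs_projections E H" and hn: "hhs_nesting E H" and hc: "hhs_consistency E H"
    and hb: "hhs_bounded_geodesic_image E H" and E: "1 \<le> E"
    and U: "U \<in> domains H" "V \<in> domains H"
    and M: "p \<in> points H" "x \<in> points H" "y \<in> points H" "z \<in> points H"
    and dU: "3 * E + 2 + 2 * C < dproj H U p x" "dproj H U p y \<le> C" "dproj H U x z \<le> C"
    and dV: "3 * E + 2 + 2 * C < dproj H V p y" "dproj H V p x \<le> C" "dproj H V y z \<le> C"
  shows "\<not> pnested H U V"
proof
  assume n: "pnested H U V"
  have mU: "Metric_space (cspace H U) (cdist H U)" and mV: "Metric_space (cspace H V) (cdist H V)" using H U by auto
  have sym: "dproj H U a b = dproj H U b a" "dproj H V a b = dproj H V b a" for a b
    using Metric_space.commute[OF mU] Metric_space.commute[OF mV] by (auto simp: dproj_def)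
  have C0: "0 \<le> C" using dU(2) Metric_space.nonneg[OF mU] unfolding dproj_def by (rule order_trans[rotated])
  have proj: "proj H V a \<in> cspace H V" if "a \<in> points H" for a
    using hp U that unfolding hhs_projections_def by blast
  note close = close_if_far_from_rho[OF H hp hn hc hb U n]
  obtain r where r: "r \<in> rho H U V" "cdist H V (proj H V p) r \<le> E + 1 + C"
  proof (rule ccontr)
    assume "\<not> thesis"
    then have "dproj H U p x \<le> 3 * E" using close[OF M(1,2) dV(2)] that by force
    then show False using dU(1) C0 by linarith
  qed
  obtain r' where r': "r' \<in> rho H U V" "cdist H V (proj H V y) r' \<le> E + 1 + C"
  proof (rule ccontr)
    assume "\<not> thesis"
    then have "dproj H U y z \<le> 3 * E" using close[OF M(3,4) dV(3)] that by force
    then show False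
      using dU C0 dproj_triangle[OF mU hp U(1) M(1,3,2)] dproj_triangle[OF mU hp U(1) M(3,4,2)] sym[of z x] by linarith
  qed
  have "rho H U V \<subseteq> cspace H V" "diam_le (cdist H V) (rho H U V) E"
    using hn U n unfolding hhs_nesting_def by blast+
  from near_same_set[OF mV proj[OF M(1)] proj[OF M(3)] this r r'] show False using dV(1) by linarith
qed

text \<open>The points \<open>p\<close>, \<open>x\<close>, \<open>z\<close>, \<open>y\<close> are the successive corners of a coarse rectangle. If its two
  directions were visible in transverse domains, two opposite corners would contradict consistency.\<close>

lemma rectangle_imp_orthogonal:
  assumes H: "\<forall>U\<in>domains H. Metric_space (cspace H U) (cdist H U) \<and> geodesic_space (cspace H U) (cdist H U)"
    and hp: "hhs_projections E H" and hn: "hhs_nesting E H" and hc: "hhs_consistency E H"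
    and hb: "hhs_bounded_geodesic_image E H" and E: "1 \<le> E"
    and U: "U \<in> domains H" "V \<in> domains H"
    and M: "p \<in> points H" "x \<in> points H" "y \<in> points H" "z \<in> points H"
    and dU: "3 * E + 2 + 2 * C < dproj H U p x" "dproj H U p y \<le> C" "dproj H U x z \<le> C"
    and dV: "3 * E + 2 + 2 * C < dproj H V p y" "dproj H V p x \<le> C" "dproj H V y z \<le> C"
  shows "U \<noteq> V" "orth H U V"
proof -
  have mU: "Metric_space (cspace H U) (cdist H U)" and mV: "Metric_space (cspace H V) (cdist H V)" using H U by auto
  have sym: "dproj H U a b = dproj H U b a" "dproj H V a b = dproj H V b a" for a b
    using Metric_space.commute[OF mU] Metric_space.commute[OF mV] by (auto simp: dproj_def)
  have "0 \<le> dproj H U p y" unfolding dproj_def by (rule Metric_space.nonneg[OF mU])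
  then have C0: "0 \<le> C" using dU(2) by linarith
  show UV: "U \<noteq> V" using dU(1) dV(2) E C0 by auto
  have proj: "proj H U a \<in> cspace H U" "proj H V a \<in> cspace H V" if "a \<in> points H" for a
    using hp U that unfolding hhs_projections_def by blast+
  have "\<not> pnested H U V"
    by (rule rectangle_imp_not_pnested[OF H hp hn hc hb E U M dU dV])
  moreover have "\<not> pnested H V U"
    by (rule rectangle_imp_not_pnested[OF H hp hn hc hb E U(2,1) M(1,3,2,4) dV dU])
  moreover have "\<not> transverse H U V"
  proof
    assume t: "transverse H U V"
    have rho: "rho H U V \<noteq> {}" "rho H U V \<subseteq> cspace H V" "diam_le (cdist H V) (rho H U V) E"
      "rho H V U \<noteq> {}" "rho H V U \<subseteq> cspace H U" "diam_le (cdist H U) (rho H V U) E"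
      and cons: "\<And>a. a \<in> points H \<Longrightarrow> min (dproj_set H U a (rho H V U)) (dproj_set H V a (rho H U V)) \<le> E"
      using hc U t unfolding hhs_consistency_def by blast+
    define nearU where "nearU = (\<lambda>a. \<exists>r\<in>rho H V U. cdist H U (proj H U a) r \<le> E + 1)"
    define nearV where "nearV = (\<lambda>a. \<exists>r\<in>rho H U V. cdist H V (proj H V a) r \<le> E + 1)"
    have near: "nearU a \<or> nearV a" if "a \<in> points H" for a
    proof (cases "dproj_set H U a (rho H V U) \<le> E")
      case True
      from set_distance_leD[OF this[unfolded dproj_set_def] _ rho(4)] show ?thesis
        unfolding nearU_def by force
    next
      case False
      then have "dproj_set H V a (rho H U V) \<le> E" using cons[OF that] by linarith
      from set_distance_leD[OF this[unfolded dproj_set_def] _ rho(1)] show ?thesis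
        unfolding nearV_def by force
    qed
    have bothU: "dproj H U a b \<le> 3 * E + 2" if "a \<in> points H" "b \<in> points H" "nearU a" "nearU b" for a b
      using that near_same_set[OF mU proj(1)[OF that(1)] proj(1)[OF that(2)] rho(5,6)] unfolding nearU_def by fastforce
    have bothV: "dproj H V a b \<le> 3 * E + 2" if "a \<in> points H" "b \<in> points H" "nearV a" "nearV b" for a b
      using that near_same_set[OF mV proj(2)[OF that(1)] proj(2)[OF that(2)] rho(2,3)] unfolding nearV_def by fastforce
    note triU = dproj_triangle[OF mU hp U(1)] and triV = dproj_triangle[OF mV hp U(2)]
    show False
    \<comment> \<open>If p is near \<rho> in U, then x and z, far from p in U, are near \<rho> in V,
      although the edge between them is long there. Otherwise the same is done with y and z and the
      domains exchanged.\<close>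
    proof (cases "nearU p")
      case True
      have "\<not> nearU x" using bothU[OF M(1,2) True] dU(1) C0 by linarith
      moreover have "\<not> nearU z"
        using bothU[OF M(1,4) True] dU triU[OF M(1,4,2)] sym(1)[of z x] C0 by linarith
      ultimately have "dproj H V x z \<le> 3 * E + 2" using bothV[OF M(2,4)] near M by blast
      then show False
        using dV triV[OF M(1,2,3)] triV[OF M(2,4,3)] sym(2)[of z y] by linarith
    next
      case False
      then have nV: "nearV p" using near M by blast
      have "\<not> nearV y" using bothV[OF M(1,3) nV] dV(1) C0 by linarith
      moreover have "\<not> nearV z"
        using bothV[OF M(1,4) nV] dV triV[OF M(1,4,3)] sym(2)[of z y] C0 by linarith
      ultimately have "dproj H U y z \<le> 3 * E + 2" using bothU[OF M(3,4)] near M by blast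
      then show False
        using dU triU[OF M(1,3,2)] triU[OF M(3,4,2)] sym(1)[of z x] by linarith
    qed
  qed
  ultimately show "orth H U V" using UV unfolding transverse_def pnested_def by blast
qed

lemma hhs_gromov_product_median_hom:
  assumes H: "\<forall>U\<in>domains H. Metric_space (cspace H U) (cdist H U) \<and> geodesic_space (cspace H U) (cdist H U) \<and>
      hyperbolic_space E (cspace H U) (cdist H U)"
    and hp: "hhs_projections E H" and \<mu>: "hhs_coarse_median H \<mu>"
  shows "\<exists>\<kappa>\<ge>0. \<forall>U\<in>domains H. \<forall>u\<in>cspace H U. \<forall>v\<in>cspace H U.
    median_hom \<kappa> (points H) \<mu> (\<lambda>x. gromov_product (cdist H U) u (proj H U x) v)"
proof -
  obtain r where r: "\<And>x y z U. x \<in> points H \<Longrightarrow> y \<in> points H \<Longrightarrow> z \<in> points H \<Longrightarrow> U \<in> domains H \<Longrightarrow>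
    \<exists>m. coarse_centre r (cspace H U) (cdist H U) (proj H U x) (proj H U y) (proj H U z) m \<and>
        cdist H U (proj H U (\<mu> x y z)) m \<le> r"
    using \<mu> unfolding hhs_coarse_median_def by blast
  \<comment> \<open>One r is the error of the coarse centre, the other its distance from the
    projected median; 3E + 1 is the four point constant.\<close>
  define \<kappa> where "\<kappa> = max 0 (2 * r + 3 * (3 * E + 1))"
  have "median_hom \<kappa> (points H) \<mu> (\<lambda>x. gromov_product (cdist H U) u (proj H U x) v)"
    if U: "U \<in> domains H" and uv: "u \<in> cspace H U" "v \<in> cspace H U" for U u v
    unfolding median_hom_def
  proof (intro ballI)
    interpret Metric_space "cspace H U" "cdist H U" using H U by blast
    have geo: "geodesic_space (cspace H U) (cdist H U)" using H U by blast
    have fp: "four_point (3 * E + 1) (cspace H U) (cdist H U)"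
      using hyperbolic_imp_four_point H U by blast
    fix x y z assume xyz: "x \<in> points H" "y \<in> points H" "z \<in> points H"
    have proj: "proj H U a \<in> cspace H U" if "a \<in> points H" for a
      using hp U that unfolding hhs_projections_def by blast
    have mu: "\<mu> x y z \<in> points H" using \<mu> xyz unfolding hhs_coarse_median_def by blast
    obtain m where m: "coarse_centre r (cspace H U) (cdist H U) (proj H U x) (proj H U y) (proj H U z) m"
      "cdist H U (proj H U (\<mu> x y z)) m \<le> r" using r[OF xyz U] by blast
    have mU: "m \<in> cspace H U" using m(1) unfolding coarse_centre_def by blast
    show "\<bar>gromov_product (cdist H U) u (proj H U (\<mu> x y z)) v -
        real_median (gromov_product (cdist H U) u (proj H U x) v) (gromov_product (cdist H U) u (proj H U y) v)
          (gromov_product (cdist H U) u (proj H U z) v)\<bar> \<le> \<kappa>"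
      using gromov_product_coarse_centre[OF m(1) geo fp proj[OF xyz(1)] proj[OF xyz(2)] proj[OF xyz(3)] uv]
        gromov_product_lipschitz[OF uv proj[OF mu] mU] m(2) unfolding \<kappa>_def by linarith
  qed
  moreover have "0 \<le> \<kappa>" by (simp add: \<kappa>_def)
  ultimately show ?thesis by blast
qed

text \<open>A large cube of contractions can be straightened to one whose \<open>n\<close> directions are visible in
  pairwise orthogonal domains.\<close>

lemma hhs_rank:
  assumes hhs: "hhs H" and \<mu>: "hhs_coarse_median H \<mu>" and cs: "contraction_space (points H) (pdist H) K \<mu>"
  shows "\<exists>n \<Lambda>. 0 \<le> \<Lambda> \<and> contraction_space.rank_lt (points H) (pdist H) K \<mu> n \<Lambda>"
proof -
  interpret C: contraction_space "points H" "pdist H" K \<mu> by (rule cs)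
  obtain E where E: "1 \<le> E" and HU: "\<forall>U\<in>domains H. Metric_space (cspace H U) (cdist H U) \<and>
      geodesic_space (cspace H U) (cdist H U) \<and> hyperbolic_space E (cspace H U) (cdist H U)"
    and hp: "hhs_projections E H" and hn: "hhs_nesting E H" and ho: "hhs_orthogonality H"
    and hc: "hhs_consistency E H" and hf: "hhs_finite_complexity E H"
    and hb: "hhs_bounded_geodesic_image E H" and hu: "hhs_uniqueness H"
    using hhs unfolding hhs_def by blast
  obtain \<kappa> where \<kappa>: "0 \<le> \<kappa>" and hom: "\<And>U u v. U \<in> domains H \<Longrightarrow> u \<in> cspace H U \<Longrightarrow> v \<in> cspace H U \<Longrightarrow>
    median_hom \<kappa> (points H) \<mu> (\<lambda>x. gromov_product (cdist H U) u (proj H U x) v)"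
    using hhs_gromov_product_median_hom[OF HU hp \<mu>] by blast
  define n where "n = Suc (nat \<lceil>E\<rceil>)"
  define R where "R = 4 * real n + 4"
  \<comment> \<open>This is the bound of \<open>thin_rectangle\<close> for error R * \<kappa>;
    \<open>far\<close> exceeds the length that \<open>rectangle_imp_orthogonal\<close> asks for when
    the short sides are at most D.\<close>
  define D where "D = 4 * (R * \<kappa>) + (3 * E + 1)"
  define far where "far = 3 * E + 3 + 2 * D"
  have R: "0 \<le> R * \<kappa>" using \<kappa> unfolding R_def by simp
  have arith: "2 * q + (3 * E + 1) < t" if "0 \<le> q" "3 * E + 3 + 2 * (4 * q + (3 * E + 1)) \<le> t" for q t
    using E that by (simp add: algebra_simps)
  have far0: "0 \<le> far" using E R unfolding far_def D_def by simp
  obtain \<theta> where \<theta>: "\<And>x y. x \<in> points H \<Longrightarrow> y \<in> points H \<Longrightarrow> \<theta> \<le> pdist H x y \<Longrightarrow> \<exists>V\<in>domains H. far \<le> dproj H V x y"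
    using hu far0 unfolding hhs_uniqueness_def by meson
  \<comment> \<open>Straightening takes R * K from the width and the contraction inequality another
    K; the remaining \<theta> lets uniqueness supply a domain.\<close>
  define \<Lambda> where "\<Lambda> = max 0 (\<theta> + R * K + K)"
  have \<Lambda>: "0 \<le> \<Lambda>" "\<theta> + R * K + K \<le> \<Lambda>" by (auto simp: \<Lambda>_def)
  have "C.rank_lt n \<Lambda>"
    unfolding C.rank_lt_def
  proof (rule notI, elim exE conjE)
    fix \<Phi> :: "nat \<Rightarrow> 'a \<Rightarrow> real" and s z u and e :: "nat \<Rightarrow> 'a"
    assume zu: "z \<in> points H" "u \<in> points H" and cube: "\<forall>i<n. C.contr (\<Phi> i) \<and> e i \<in> points H \<and>
      \<Phi> i z \<le> s i \<and> s i + \<Lambda> \<le> \<Phi> i u \<and> s i + \<Lambda> \<le> \<Phi> i (e i) \<and> (\<forall>j<n. j \<noteq> i \<longrightarrow> \<Phi> i (e j) \<le> s i)"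
    have eM: "e i \<in> points H" if "i < n" for i using cube that by blast
    show False
    proof (rule disjoint_joins[of "points H" \<mu> z u n e, OF C.median_closed zu eM, folded R_def])
      fix p e' c assume M: "p \<in> points H" "\<And>i. i < n \<Longrightarrow> e' i \<in> points H"
        "\<And>i j. i < n \<Longrightarrow> j < n \<Longrightarrow> c i j \<in> points H"
        and rect: "\<And>\<kappa> \<Psi> i j. median_hom \<kappa> (points H) \<mu> \<Psi> \<Longrightarrow> i < n \<Longrightarrow> j < n \<Longrightarrow> i \<noteq> j \<Longrightarrow>
           \<bar>\<Psi> (e' i) - \<Psi> p\<bar> \<le> R * \<kappa> \<and> \<bar>\<Psi> (c i j) - \<Psi> (e' j)\<bar> \<le> R * \<kappa> \<or>
           \<bar>\<Psi> (e' j) - \<Psi> p\<bar> \<le> R * \<kappa> \<and> \<bar>\<Psi> (c i j) - \<Psi> (e' i)\<bar> \<le> R * \<kappa>"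
        and sep: "\<And>\<kappa> \<Psi> k s t. median_hom \<kappa> (points H) \<mu> \<Psi> \<Longrightarrow> k < n \<Longrightarrow> s \<le> t \<Longrightarrow> \<Psi> z \<le> s \<Longrightarrow> t \<le> \<Psi> u \<Longrightarrow>
           (\<And>i. i < n \<Longrightarrow> i \<noteq> k \<Longrightarrow> \<Psi> (e i) \<le> s) \<Longrightarrow> t \<le> \<Psi> (e k) \<Longrightarrow> t - s - R * \<kappa> \<le> \<Psi> (e' k) - \<Psi> p"
      have "\<exists>V\<in>domains H. far \<le> dproj H V p (e' i)" if i: "i < n" for i
      proof (rule \<theta>[OF M(1) M(2)[OF i]])
        have \<Phi>: "C.contr (\<Phi> i)" using cube i by blast
        have "(s i + \<Lambda>) - s i - R * K \<le> \<Phi> i (e' i) - \<Phi> i p"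
          by (rule sep[OF C.contr_imp_median_hom[OF \<Phi>] i]) (use cube i \<Lambda>(1) in auto)
        then show "\<theta> \<le> pdist H p (e' i)"
          using C.contrD(2)[OF \<Phi> M(2)[OF i] M(1)] C.commute[of p "e' i"] \<Lambda>(2) by linarith
      qed
      then obtain U where U: "\<And>i. i < n \<Longrightarrow> U i \<in> domains H" "\<And>i. i < n \<Longrightarrow> far \<le> dproj H (U i) p (e' i)"
        by metis
      have thin: "dproj H (U i) p (e' j) \<le> D \<and> dproj H (U i) (e' i) q \<le> D"
        if ij: "i < n" "j < n" "i \<noteq> j" and q: "q = c i j \<or> q = c j i" for i j q
      proof -
        interpret Metric_space "cspace H (U i)" "cdist H (U i)" using HU U(1) ij by blast
        have fp: "four_point (3 * E + 1) (cspace H (U i)) (cdist H (U i))"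
          using hyperbolic_imp_four_point HU U(1) ij by blast
        have proj: "proj H (U i) a \<in> cspace H (U i)" if "a \<in> points H" for a
          using hp U(1)[OF ij(1)] that unfolding hhs_projections_def by blast
        have qM: "q \<in> points H" using q M(3) ij by blast
        have "let \<Psi> = \<lambda>a. gromov_product (cdist H (U i)) u a v in
           \<bar>\<Psi> (proj H (U i) (e' i)) - \<Psi> (proj H (U i) p)\<bar> \<le> R * \<kappa> \<and>
           \<bar>\<Psi> (proj H (U i) q) - \<Psi> (proj H (U i) (e' j))\<bar> \<le> R * \<kappa> \<or>
           \<bar>\<Psi> (proj H (U i) (e' j)) - \<Psi> (proj H (U i) p)\<bar> \<le> R * \<kappa> \<and>
           \<bar>\<Psi> (proj H (U i) q) - \<Psi> (proj H (U i) (e' i))\<bar> \<le> R * \<kappa>"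
          if "u \<in> cspace H (U i)" "v \<in> cspace H (U i)" for u v
          using rect[OF hom[OF U(1)[OF ij(1)] that] ij] rect[OF hom[OF U(1)[OF ij(1)] that] ij(2,1) ij(3)[symmetric]] q
          unfolding Let_def by blast
        note thin = thin_rectangle[OF fp proj[OF M(1)] proj[OF M(2)[OF ij(1)]] proj[OF M(2)[OF ij(2)]] proj[OF qM] this]
        have "2 * (R * \<kappa>) + (3 * E + 1) < cdist H (U i) (proj H (U i) p) (proj H (U i) (e' i))"
          using arith[OF R] U(2)[OF ij(1)] unfolding far_def D_def dproj_def by blast
        from thin[OF _ _ this] show ?thesis using R unfolding D_def dproj_def by fastforce
      qed
      have orth: "U i \<noteq> U j \<and> orth H (U i) (U j)" if ij: "i < n" "j < n" "i \<noteq> j" for i j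
      proof -
        have HU': "\<forall>U\<in>domains H. Metric_space (cspace H U) (cdist H U) \<and> geodesic_space (cspace H U) (cdist H U)"
          using HU by blast
        have "3 * E + 2 + 2 * D < dproj H (U i) p (e' i)" "3 * E + 2 + 2 * D < dproj H (U j) p (e' j)"
          using U(2) ij unfolding far_def by fastforce+
        then show ?thesis
          using rectangle_imp_orthogonal[OF HU' hp hn hc hb E U(1)[OF ij(1)] U(1)[OF ij(2)] M(1) M(2)[OF ij(1)]
              M(2)[OF ij(2)] M(3)[OF ij(1,2)], of D]
            thin[OF ij, of "c i j"] thin[OF ij(2,1) ij(3)[symmetric], of "c i j"] by blast
      qed
      have "inj_on U {..<n}" using orth unfolding inj_on_def by blast
      then have "card (U ` {..<n}) = n" by (simp add: card_image)
      moreover have "real (card (U ` {..<n})) \<le> E"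
        by (rule card_orthogonal_family_le[OF hn ho hf]) (use U(1) orth E in auto)
      ultimately show False unfolding n_def by linarith
    qed
  qed
  then show ?thesis using \<Lambda>(1) by blast
qed

theorem corollaryE:
  fixes H :: "('x, 'u, 'c) hhs_data"
    and \<mu> :: "'x \<Rightarrow> 'x \<Rightarrow> 'x \<Rightarrow> 'x"
    and K :: real
    and \<sigma> :: "'x \<Rightarrow> 'x \<Rightarrow> real"
  assumes "hhs H"
    and "geodesic_space (points H) (pdist H)"
    and "hhs_coarse_median H \<mu>"
    and "K > 0"
    and "\<sigma> = contraction_dist K (points H) (pdist H) \<mu>"
  shows "\<exists>\<gamma>. quasigeodesic_bicombing (points H) \<sigma> \<gamma> \<and>
             rough_geodesic_lines (points H) \<sigma> \<gamma> \<and>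
             roughly_conical (points H) \<sigma> \<gamma> \<and>
             roughly_reversible (points H) \<sigma> \<gamma> \<and>
             coarsely_equivariant (hhs_automorphisms H) on_points (points H) \<sigma> \<gamma>"
proof -
  have cs: "contraction_space (points H) (pdist H) K \<mu>"
    using assms unfolding contraction_space_def contraction_space_axioms_def hhs_def hhs_coarse_median_def by blast
  interpret C: contraction_space "points H" "pdist H" K \<mu> by (rule cs)
  obtain n \<Lambda> where rank: "0 \<le> \<Lambda>" "C.rank_lt n \<Lambda>"
    using hhs_rank[OF assms(1,3) cs] by blast
  show ?thesis
    unfolding assms(5)
  proof (rule C.exists_bicombing[OF rank(2,1)])
    show "isometry_between (points H) (pdist H) (points H) (pdist H) (on_points g)"
      if "g \<in> hhs_automorphisms H" for g
      using that unfolding hhs_automorphisms_def by blast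
    show "\<mu> (on_points g x) (on_points g y) (on_points g z) = on_points g (\<mu> x y z)"
      if "g \<in> hhs_automorphisms H" "x \<in> points H" "y \<in> points H" "z \<in> points H" for g x y z
      using assms(3) that unfolding hhs_coarse_median_def by blast
  qed
qed

end
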